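(* Fix $0<c<e^{-1/2}$. If $p=p(n)=(1+o(1))\,c\,n^{-1/2}$ as $n\to\infty$, then $$\lim_{n\to\infty}\frac1{n^{3/2}}\log\mathbb P_p(X=0)=\frac12\left[\frac{W(2c^2)^{3/2}+3W(2c^2)^{1/2}}{3\sqrt2}-c\right].$$
   Context: $\mathbb P_p$ denotes probability for the Erdős–Rényi random graph $G(n,p)$ on $n$ labeled vertices, and $X$ is its number of triangles. $W$ is the Lambert-W function, the inverse of $x\mapsto xe^x$ on the nonnegative reals. *)

theory Defs
  imports "HOL-Probability.Probability" "HOL-Library.Landau_Symbols"
begin

definition possible_edges :: "nat \<Rightarrow> nat set set" where
  "possible_edges n = {e. e \<subseteq> {..<n} \<and> card e = 2}"

(* A graph on the labelled vertex set {..<n} is represented by its edge set.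
   Outside of possible_edges n the product measure takes the default value False. *)
definition erdos_renyi :: "nat \<Rightarrow> real \<Rightarrow> nat set set pmf" where
  "erdos_renyi n p =
     map_pmf (\<lambda>f. {e \<in> possible_edges n. f e})
       (Pi_pmf (possible_edges n) False (\<lambda>_. bernoulli_pmf p))"

definition triangles :: "nat \<Rightarrow> nat set set \<Rightarrow> nat set set" where
  "triangles n E = {T. T \<subseteq> {..<n} \<and> card T = 3 \<and> (\<forall>u\<in>T. \<forall>v\<in>T. u \<noteq> v \<longrightarrow> {u, v} \<in> E)}"

definition num_triangles :: "nat \<Rightarrow> nat set set \<Rightarrow> nat" where
  "num_triangles n E = card (triangles n E)"

definition lambert_W :: "real \<Rightarrow> real" where
  "lambert_W = the_inv_into {0..} (\<lambda>x. x * exp x)"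

lemma finite_possible_edges [simp]: "finite (possible_edges n)"
  unfolding possible_edges_def by (rule finite_subset[of _ "Pow {..<n}"]) auto

lemma bij_betw_mult_exp: "bij_betw (\<lambda>x::real. x * exp x) {0..} {0..}"
proof (rule bij_betwI')
  have less: "x * exp x < y * exp y" if "0 \<le> x" "x < y" for x y :: real
    using that by (intro mult_strict_mono) auto
  show "(x * exp x = y * exp y) = (x = y)" if "x \<in> {0..}" "y \<in> {0..}" for x y :: real
    using less[of x y] less[of y x] that by (cases x y rule: linorder_cases) auto
  show "x * exp x \<in> {0..}" if "x \<in> {0..}" for x :: real
    using that by simp
  show "\<exists>x\<in>{0..}. y = x * exp x" if "y \<in> {0..}" for y :: real
  proof -
    have "\<exists>x. 0 \<le> x \<and> x \<le> y \<and> x * exp x = y"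
    proof (rule IVT')
      show "y \<le> y * exp y"
        using that mult_left_mono[of 1 "exp y" y] by simp
    qed (use that in \<open>auto intro!: continuous_intros\<close>)
    then show ?thesis by force
  qed
qed

lemma lambert_W_nonneg: "0 \<le> y \<Longrightarrow> 0 \<le> lambert_W y"
  using bij_betw_the_inv_into[OF bij_betw_mult_exp]
  by (auto simp: lambert_W_def bij_betw_def)

lemma lambert_W_mult_exp: "0 \<le> y \<Longrightarrow> lambert_W y * exp (lambert_W y) = y"
  unfolding lambert_W_def
  by (rule f_the_inv_into_f_bij_betw[OF bij_betw_mult_exp]) auto

lemma lambert_W_eqI: "0 \<le> x \<Longrightarrow> x * exp x = y \<Longrightarrow> lambert_W y = x"
  unfolding lambert_W_def
  using the_inv_into_f_f[OF bij_betw_imp_inj_on[OF bij_betw_mult_exp], of x] by auto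

end

theory Submission
  imports Defs "HOL-Real_Asymp.Real_Asymp"
begin

text \<open>
  Triangle-free graphs are the independent sets of the 3-uniform hypergraph whose vertices are the
  edges of \<open>K\<^sub>n\<close> and whose hyperedges are the triangles, so with \<open>l = p / (1 - p)\<close> the probability
  is \<open>(1 - p)\<^sup>N Z(l)\<close> for the independence polynomial \<open>Z\<close>. This hypergraph is linear and
  \<open>(n - 2)\<close>-regular, and so, up to a bounded error, is every hypergraph obtained from it by boundedly
  many conditionings on a vertex. Telescoping over the link of a vertex, the largest and smallest
  occupation ratios \<open>y / \<surd>n\<close> in these classes are therefore related by the decreasing map
  \<open>y \<mapsto> s exp (- y\<^sup>2)\<close>, where \<open>l = s / \<surd>n\<close>. For \<open>2 s\<^sup>2 < 1\<close> this map is a contraction on \<open>[0, s]\<close>, so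
  all ratios are asymptotic to its fixed point, i.e. to the \<open>y\<close> with \<open>s = y exp (y\<^sup>2)\<close>.
  They determine the logarithmic derivative of \<open>Z\<close>, and integrating along \<open>s = y exp (y\<^sup>2)\<close>
  turns the integrand into the polynomial \<open>(1 + 2 y\<^sup>2) / 2\<close>.
\<close>

subsection \<open>Independence polynomials\<close>

definition indep :: "'a set \<Rightarrow> 'a set set \<Rightarrow> 'a set set" where
  "indep A C = {S. S \<subseteq> A \<and> (\<forall>c\<in>C. \<not> c \<subseteq> S)}"

definition ipoly :: "'a set \<Rightarrow> 'a set set \<Rightarrow> real \<Rightarrow> real" where
  "ipoly A C l = (\<Sum>S\<in>indep A C. l ^ card S)"

text \<open>What the other elements must avoid once \<open>v\<close> is occupied; constraints
  without \<open>v\<close> carry over unchanged.\<close>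

definition contr :: "'a set set \<Rightarrow> 'a \<Rightarrow> 'a set set" where
  "contr C v = (\<lambda>c. c - {v}) ` C"

text \<open>The odds that \<open>v\<close> is occupied in the hard-core model of activity
  \<open>l\<close>. Written with sums over \<open>indep A C\<close>, it depends only on that family,
  so systems with the same independent sets are interchangeable.\<close>

definition occ_ratio :: "'a set \<Rightarrow> 'a set set \<Rightarrow> real \<Rightarrow> 'a \<Rightarrow> real" where
  "occ_ratio A C l v =
     (\<Sum>S | S \<in> indep A C \<and> v \<in> S. l ^ card S) / (\<Sum>S | S \<in> indep A C \<and> v \<notin> S. l ^ card S)"

lemma finite_indep [simp]: "finite A \<Longrightarrow> finite (indep A C)"
  by (rule finite_subset[of _ "Pow A"]) (auto simp: indep_def)

lemma indep_not_mem: "{S. S \<in> indep A C \<and> v \<notin> S} = indep (A - {v}) C"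
  by (auto simp: indep_def)

lemma indep_mem:
  assumes "v \<in> A"
  shows "{S. S \<in> indep A C \<and> v \<in> S} = insert v ` indep (A - {v}) (contr C v)"
proof (intro equalityI subsetI)
  fix S assume "S \<in> {S. S \<in> indep A C \<and> v \<in> S}"
  then have "S = insert v (S - {v})" "S - {v} \<in> indep (A - {v}) (contr C v)"
    by (auto simp: indep_def contr_def)
  then show "S \<in> insert v ` indep (A - {v}) (contr C v)" by blast
qed (use assms in \<open>auto simp: indep_def contr_def\<close>)

lemma sum_indep_card_mem:
  assumes "v \<in> A" "finite A"
  shows "(\<Sum>S | S \<in> indep A C \<and> v \<in> S. f (card S)) = (\<Sum>S\<in>indep (A - {v}) (contr C v). f (Suc (card S)))"
proof -
  have "inj_on (insert v) (indep (A - {v}) (contr C v))"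
    by (rule inj_onI) (auto simp: indep_def)
  then have "(\<Sum>S | S \<in> indep A C \<and> v \<in> S. f (card S))
    = (\<Sum>S\<in>indep (A - {v}) (contr C v). f (card (insert v S)))"
    by (simp add: indep_mem[OF assms(1)] sum.reindex)
  also have "\<dots> = (\<Sum>S\<in>indep (A - {v}) (contr C v). f (Suc (card S)))"
  proof (rule sum.cong)
    fix S assume "S \<in> indep (A - {v}) (contr C v)"
    then have "finite S" "v \<notin> S" using assms(2) by (auto simp: indep_def intro: finite_subset)
    then show "f (card (insert v S)) = f (Suc (card S))" by simp
  qed simp
  finally show ?thesis .
qed

lemma sum_indep_mem:
  "v \<in> A \<Longrightarrow> finite A \<Longrightarrow>
    (\<Sum>S | S \<in> indep A C \<and> v \<in> S. l ^ card S) = l * ipoly (A - {v}) (contr C v) l"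
  by (simp add: sum_indep_card_mem[where f = "\<lambda>k. l ^ k"] ipoly_def sum_distrib_left)

lemma occ_ratio_eq:
  "v \<in> A \<Longrightarrow> finite A \<Longrightarrow>
    occ_ratio A C l v = l * ipoly (A - {v}) (contr C v) l / ipoly (A - {v}) C l"
  unfolding occ_ratio_def indep_not_mem by (simp only: sum_indep_mem) (simp add: ipoly_def)

lemma ipoly_split:
  assumes "v \<in> A" "finite A"
  shows "ipoly A C l = ipoly (A - {v}) C l + l * ipoly (A - {v}) (contr C v) l"
proof -
  have "ipoly A C l = (\<Sum>S | S \<in> indep A C \<and> v \<notin> S. l ^ card S)
      + (\<Sum>S | S \<in> indep A C \<and> v \<in> S. l ^ card S)"
    unfolding ipoly_def using assms(2)
    by (subst sum.union_disjoint[symmetric]) (auto intro: sum.cong)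
  then show ?thesis by (simp only: sum_indep_mem[OF assms] indep_not_mem) (simp add: ipoly_def)
qed

lemma ipoly_nonneg: "0 \<le> l \<Longrightarrow> 0 \<le> ipoly A C l"
  by (auto simp: ipoly_def intro: sum_nonneg)

lemma ipoly_ge_1:
  fixes A :: "'a set"
  assumes "finite A" "0 \<le> l" "{} \<notin> C"
  shows "1 \<le> ipoly A C l"
proof -
  have "{} \<in> indep A C" using assms by (auto simp: indep_def)
  then have "(\<Sum>S\<in>{{} :: 'a set}. l ^ card S) \<le> ipoly A C l"
    unfolding ipoly_def using assms by (intro sum_mono2) auto
  then show ?thesis by simp
qed

lemma ipoly_mono:
  "finite B \<Longrightarrow> 0 \<le> l \<Longrightarrow> indep A C \<subseteq> indep B D \<Longrightarrow> ipoly A C l \<le> ipoly B D l"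
  unfolding ipoly_def by (rule sum_mono2) simp_all

lemma ipoly_occ_ratio:
  assumes "v \<in> A" "finite A" "0 \<le> l" "{} \<notin> C"
  shows "ipoly A C l = ipoly (A - {v}) C l * (1 + occ_ratio A C l v)"
  using ipoly_ge_1[of "A - {v}" l C] assms
  by (simp add: ipoly_split[OF assms(1,2)] occ_ratio_eq field_simps)

lemma occ_ratio_nonneg: "0 \<le> l \<Longrightarrow> 0 \<le> occ_ratio A C l v"
  by (auto simp: occ_ratio_def intro!: divide_nonneg_nonneg sum_nonneg)

lemma occ_ratio_le:
  assumes "v \<in> A" "finite A" "0 \<le> l" "{} \<notin> C"
  shows "occ_ratio A C l v \<le> l"
proof -
  have "ipoly (A - {v}) (contr C v) l \<le> ipoly (A - {v}) C l"
    using assms by (intro ipoly_mono) (auto simp: indep_def contr_def)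
  then show ?thesis using ipoly_ge_1[of "A - {v}" l C] assms
    by (simp add: occ_ratio_eq divide_le_eq mult_left_mono)
qed

text \<open>The new pair removes the sets containing both \<open>a\<close> and \<open>b\<close>.
  Their probability in the hard-core measure is that of \<open>a\<close>, namely
  \<open>r / (1 + r)\<close>, times that of \<open>b\<close> given \<open>a\<close>; conditioning on
  \<open>a\<close> gives the contracted system.\<close>

lemma ipoly_insert_pair:
  assumes "a \<in> A" "b \<in> A" "a \<noteq> b" "finite A" "0 \<le> l" "{} \<notin> C" "{a} \<notin> C"
  shows "ipoly A (insert {a, b} C) l = ipoly A C l *
    (1 - occ_ratio A C l a / (1 + occ_ratio A C l a) *
      (occ_ratio (A - {a}) (contr C a) l b / (1 + occ_ratio (A - {a}) (contr C a) l b)))"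
proof -
  let ?D = "contr C a"
  have D: "{} \<notin> ?D" using assms by (auto simp: contr_def subset_singleton_iff)
  have fin: "finite (A - {a})" and b: "b \<in> A - {a}" using assms by auto
  define r where "r = occ_ratio A C l a"
  define r' where "r' = occ_ratio (A - {a}) ?D l b"
  have r: "0 \<le> r" "0 \<le> r'" using assms by (auto simp: r_def r'_def occ_ratio_nonneg)
  define P where "P = ipoly (A - {a}) C l"
  define Q where "Q = ipoly (A - {a}) ?D l"
  define Q' where "Q' = ipoly (A - {a} - {b}) ?D l"
  have P: "P > 0" using ipoly_ge_1[of "A - {a}" l C] assms by (auto simp: P_def)
  have 1: "ipoly A C l = P * (1 + r)"
    unfolding P_def r_def by (rule ipoly_occ_ratio) (use assms in auto)
  have 2: "Q = Q' * (1 + r')"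
    unfolding Q_def Q'_def r'_def by (rule ipoly_occ_ratio[OF b fin _ D]) (use assms in auto)
  have 3: "l * Q = r * P"
    using P assms by (simp add: r_def occ_ratio_eq Q_def P_def)
  have 4: "ipoly (A - {a}) (insert {a, b} C) l = P"
    unfolding P_def ipoly_def by (rule sum.cong) (auto simp: indep_def)
  \<comment> \<open>Contraction at \<open>a\<close> turns the new pair into the singleton
    \<open>{b}\<close>, which forbids \<open>b\<close>.\<close>
  have "indep (A - {a}) (contr (insert {a, b} C) a) = indep (A - {a} - {b}) ?D"
  proof -
    have "contr (insert {a, b} C) a = insert {b} ?D"
      using assms(3) by (auto simp: contr_def)
    then show ?thesis by (auto simp: indep_def)
  qed
  then have 5: "ipoly (A - {a}) (contr (insert {a, b} C) a) l = Q'"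
    unfolding Q'_def ipoly_def by simp
  have "ipoly A (insert {a, b} C) l = P + l * Q'"
    using ipoly_split[OF assms(1,4), of "insert {a, b} C" l] 4 5 by simp
  also have "l * Q' = r * P / (1 + r')"
  proof -
    have "Q' = Q / (1 + r')" using 2 r by simp
    then show ?thesis using 3 by (metis times_divide_eq_right)
  qed
  also have "P + r * P / (1 + r') = P * (1 + r) * (1 - r / (1 + r) * (r' / (1 + r')))"
  proof -
    have "(1 + r) * (r / (1 + r)) = r" "r' / (1 + r') = 1 - 1 / (1 + r')"
      using r by (auto simp: diff_divide_eq_iff)
    then have "P * ((1 + r) - ((1 + r) * (r / (1 + r))) * (r' / (1 + r'))) = P + r * P / (1 + r')"
      by (simp only:) (simp add: algebra_simps)
    then show ?thesis by (simp only: right_diff_distrib mult_1_right mult.assoc)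
  qed
  finally show ?thesis unfolding 1 r_def r'_def .
qed

subsection \<open>Almost regular linear hypergraphs\<close>

text \<open>Constraints of size two arise from triples by conditioning on one of their vertices; \<open>lk\<close>
  records the triples at a vertex and \<open>nb\<close> the pairs. Constraints not contained in \<open>A\<close> are void.\<close>

definition lk :: "'a set \<Rightarrow> 'a set set \<Rightarrow> 'a \<Rightarrow> 'a set set" where
  "lk A C v = {t. t \<subseteq> A \<and> v \<notin> t \<and> card t = 2 \<and> insert v t \<in> C}"

definition nb :: "'a set \<Rightarrow> 'a set set \<Rightarrow> 'a \<Rightarrow> 'a set" where
  "nb A C v = {b \<in> A. b \<noteq> v \<and> {v, b} \<in> C}"

text \<open>\<open>m\<close> is the nominal number of triples at a vertex; \<open>k\<close> bounds
  both the deficit from it and the number of pairs there. Only constraints inside \<open>A\<close>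
  count, so vertices can be deleted without touching \<open>C\<close>. The third clause is
  linearity; two distinct pairs meet in at most one element anyway.\<close>

definition near_regular :: "nat \<Rightarrow> nat \<Rightarrow> 'a set \<Rightarrow> 'a set set \<Rightarrow> bool" where
  "near_regular m k A C \<longleftrightarrow> finite A
     \<and> (\<forall>c\<in>C. c \<subseteq> A \<longrightarrow> card c = 2 \<or> card c = 3)
     \<and> (\<forall>c\<in>C. \<forall>d\<in>C. c \<subseteq> A \<longrightarrow> d \<subseteq> A \<longrightarrow> card c = 3 \<longrightarrow> c \<noteq> d \<longrightarrow> card (c \<inter> d) \<le> 1)
     \<and> (\<forall>v\<in>A. card (nb A C v) \<le> k \<and> card (lk A C v) \<le> m \<and> m \<le> card (lk A C v) + k)"

lemma near_regularD:
  assumes "near_regular m k A C"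
  shows "finite A"
    "\<And>c. c \<in> C \<Longrightarrow> c \<subseteq> A \<Longrightarrow> card c = 2 \<or> card c = 3"
    "\<And>c d. c \<in> C \<Longrightarrow> d \<in> C \<Longrightarrow> c \<subseteq> A \<Longrightarrow> d \<subseteq> A \<Longrightarrow> card c = 3 \<Longrightarrow> card (c \<inter> d) \<ge> 2 \<Longrightarrow> c = d"
    "\<And>v. v \<in> A \<Longrightarrow> card (nb A C v) \<le> k"
    "\<And>v. v \<in> A \<Longrightarrow> card (lk A C v) \<le> m"
    "\<And>v. v \<in> A \<Longrightarrow> m \<le> card (lk A C v) + k"
    "{} \<notin> C"
proof -
  have *: "finite A" "\<forall>c\<in>C. c \<subseteq> A \<longrightarrow> card c = 2 \<or> card c = 3"
    "\<forall>c\<in>C. \<forall>d\<in>C. c \<subseteq> A \<longrightarrow> d \<subseteq> A \<longrightarrow> card c = 3 \<longrightarrow> c \<noteq> d \<longrightarrow> card (c \<inter> d) \<le> 1"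
    "\<forall>v\<in>A. card (nb A C v) \<le> k \<and> card (lk A C v) \<le> m \<and> m \<le> card (lk A C v) + k"
    using assms unfolding near_regular_def by blast+
  show "finite A" by (fact *(1))
  show "card c = 2 \<or> card c = 3" if "c \<in> C" "c \<subseteq> A" for c using *(2) that by blast
  show "c = d" if "c \<in> C" "d \<in> C" "c \<subseteq> A" "d \<subseteq> A" "card c = 3" "card (c \<inter> d) \<ge> 2" for c d
  proof (rule ccontr)
    assume "c \<noteq> d"
    then have "card (c \<inter> d) \<le> 1" using *(3) that by blast
    then show False using that by simp
  qed
  show "card (nb A C v) \<le> k" "card (lk A C v) \<le> m" "m \<le> card (lk A C v) + k" if "v \<in> A" for v
    using *(4) that by blast+
  show "{} \<notin> C" using *(2) by fastforce
qed

lemma near_regular_mono: "near_regular m k A C \<Longrightarrow> k \<le> k' \<Longrightarrow> near_regular m k' A C"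
  by (fastforce simp: near_regular_def)

lemma finite_lk [simp]: "finite A \<Longrightarrow> finite (lk A C v)"
  by (rule finite_subset[of _ "Pow A"]) (auto simp: lk_def)

lemma finite_nb [simp]: "finite A \<Longrightarrow> finite (nb A C v)"
  by (auto simp: nb_def)

lemma card_ge_2I: "finite X \<Longrightarrow> a \<in> X \<Longrightarrow> b \<in> X \<Longrightarrow> a \<noteq> b \<Longrightarrow> 2 \<le> card X"
  using card_mono[of X "{a, b}"] by auto

text \<open>By linearity: the triples \<open>insert v s\<close> and \<open>insert v t\<close> share
  \<open>v\<close> and \<open>x\<close>, hence coincide. So the link of a vertex is a
  matching.\<close>

lemma lk_disjoint:
  assumes "near_regular m k A C" "v \<in> A" "s \<in> lk A C v" "t \<in> lk A C v" "x \<in> s" "x \<in> t"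
  shows "s = t"
proof -
  note near = near_regularD[OF assms(1)]
  have fin: "finite s" "finite t" using assms near(1) by (auto simp: lk_def intro: finite_subset)
  have "insert v s = insert v t"
  proof (rule near(3))
    show "2 \<le> card (insert v s \<inter> insert v t)"
      using assms fin by (intro card_ge_2I[of _ v x]) (auto simp: lk_def)
  qed (use assms fin in \<open>auto simp: lk_def\<close>)
  then show ?thesis using assms by (auto simp: lk_def)
qed

section \<open>Closure of the class under deletion and conditioning\<close>

lemma near_regular_del:
  assumes "near_regular m k A C"
  shows "near_regular m (Suc k) (A - {b}) C"
proof -
  note near = near_regularD[OF assms]
  have "m \<le> card (lk (A - {b}) C v) + Suc k" if v: "v \<in> A - {b}" for v
  proof -
    \<comment> \<open>Deleting \<open>b\<close> voids only the triples at \<open>v\<close> that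
      contain \<open>b\<close>, and by linearity there is at most one.\<close>
    let ?B = "{t \<in> lk A C v. b \<in> t}"
    have "lk A C v = lk (A - {b}) C v \<union> ?B" by (auto simp: lk_def)
    then have "card (lk A C v) \<le> card (lk (A - {b}) C v) + card ?B"
      by (metis card_Un_le)
    moreover have "card ?B \<le> 1"
      using lk_disjoint[OF assms] v near(1) by (subst card_le_Suc0_iff_eq[unfolded One_nat_def[symmetric]]) auto
    ultimately show ?thesis using near(6)[of v] v by auto
  qed
  moreover have "card (nb (A - {b}) C v) \<le> Suc k" if v: "v \<in> A - {b}" for v
    using card_mono[of "nb A C v" "nb (A - {b}) C v"] near(1) near(4)[of v] v
    by (force simp: nb_def)
  moreover have "card (lk (A - {b}) C v) \<le> m" if v: "v \<in> A - {b}" for v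
    using card_mono[of "lk A C v" "lk (A - {b}) C v"] near(1) near(5)[of v] v
    by (force simp: lk_def)
  ultimately show ?thesis
    using assms unfolding near_regular_def by (auto simp: subset_Diff_insert)
qed

lemma near_regular_del_set:
  assumes "finite X" "near_regular m k A C"
  shows "near_regular m (k + card X) (A - X) C"
  using assms
proof (induction X rule: finite_induct)
  case (insert x X)
  then have "near_regular m (Suc (k + card X)) (A - X - {x}) C"
    by (intro near_regular_del) auto
  then show ?case using insert by (simp add: Diff_insert[of A x X])
qed simp

text \<open>The link is a matching, so each vertex gains at most one pair. A triple avoiding
  \<open>v\<close> but containing a pair of \<open>T\<close> would share two elements with the
  triple formed by that pair and \<open>v\<close>. \<open>T\<close> may be any part of the link,
  since the pairs will be added one at a time.\<close>

lemma near_regular_link: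
  assumes "near_regular m k A C" "v \<in> A" "T \<subseteq> lk A C v"
  shows "near_regular m (Suc k) (A - {v}) (C \<union> T)"
proof -
  note near = near_regularD[OF assms(1)]
  note del = near_regularD[OF near_regular_del[OF assms(1), of v]]
  have T: "card t = 2" "t \<subseteq> A" "v \<notin> t" "insert v t \<in> C" if "t \<in> T" for t
    using that assms(3) by (auto simp: lk_def)
  have finT: "finite t" if "t \<in> T" for t using T(1)[OF that] card.infinite by fastforce
  have not_pair: "card (c \<inter> t) \<le> 1" if "c \<in> C" "c \<subseteq> A - {v}" "card c = 3" "t \<in> T" for c t
  proof (rule ccontr)
    assume "\<not> card (c \<inter> t) \<le> 1"
    moreover have "card (c \<inter> t) \<le> card (c \<inter> insert v t)"
      using finT[OF that(4)] by (intro card_mono) auto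
    ultimately have "c = insert v t"
      using near(3)[of c "insert v t"] T[OF that(4)] that assms(2) by auto
    then show False using that by auto
  qed
  have lk: "lk (A - {v}) (C \<union> T) w = lk (A - {v}) C w" for w
  proof -
    have "insert w t \<notin> T" if "card t = 2" "w \<notin> t" for t
      using T(1)[of "insert w t"] that card.infinite[of t] by (cases "finite t") auto
    then show ?thesis by (auto simp: lk_def)
  qed
  have nb: "card (nb (A - {v}) (C \<union> T) w) \<le> Suc k" if "w \<in> A - {v}" for w
  proof -
    let ?B = "{b. {w, b} \<in> T}"
    have B: "finite ?B"
      by (rule finite_subset[of _ A]) (use T near(1) in auto)
    have eq: "b = b'" if "{w, b} \<in> T" "{w, b'} \<in> T" for b b'
    proof -
      have "{w, b} = {w, b'}"
        using lk_disjoint[OF assms(1,2)] assms(3) that by blast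
      then show ?thesis by (metis doubleton_eq_iff)
    qed
    then have "card ?B \<le> 1"
      using B by (subst card_le_Suc0_iff_eq[unfolded One_nat_def[symmetric]]) auto
    moreover have "card (nb (A - {v}) (C \<union> T) w) \<le> card (nb A C w \<union> ?B)"
      using B near(1) by (intro card_mono) (auto simp: nb_def)
    ultimately show ?thesis using card_Un_le[of "nb A C w" ?B] near(4)[of w] that by auto
  qed
  show ?thesis
    unfolding near_regular_def lk
  proof (intro conjI ballI impI)
    fix c d assume "c \<in> C \<union> T" "d \<in> C \<union> T" "c \<subseteq> A - {v}" "d \<subseteq> A - {v}" "card c = 3" "c \<noteq> d"
    then show "card (c \<inter> d) \<le> 1"
      using T(1) not_pair near(3)[of c d] by (cases "d \<in> T") (fastforce)+
  qed (use near(1) del T nb in auto)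
qed

text \<open>Once \<open>v\<close> is occupied, its pairs forbid their other element and its triples
  become pairs. The old constraints through \<open>v\<close> stay in \<open>C\<close> but are void,
  as \<open>v\<close> has left the ground set. In this form the conditioned system is again one of
  pairs and triples.\<close>

lemma indep_contr:
  assumes "near_regular m k A C" "v \<in> A"
  shows "indep (A - {v}) (contr C v) = indep (A - nb A C v - {v}) (C \<union> lk A C v)" (is "?L = ?R")
proof (intro equalityI subsetI)
  fix S assume S: "S \<in> ?L"
  have *: "\<not> c - {v} \<subseteq> S" if "c \<in> C" for c
    using S that by (auto simp: indep_def contr_def)
  have "b \<notin> nb A C v" if "b \<in> S" for b
    using *[of "{v, b}"] that by (auto simp: nb_def)
  moreover have "\<not> t \<subseteq> S" if "t \<in> lk A C v" for t
    using *[of "insert v t"] that by (auto simp: lk_def)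
  moreover have "\<not> c \<subseteq> S" if "c \<in> C" for c using *[OF that] by blast
  ultimately show "S \<in> ?R" using S by (auto simp: indep_def)
next
  fix S assume S: "S \<in> ?R"
  have "\<not> c - {v} \<subseteq> S" if c: "c \<in> C" for c
  proof
    assume sub: "c - {v} \<subseteq> S"
    then have cA: "c \<subseteq> A" using S assms(2) by (auto simp: indep_def)
    have v: "v \<in> c" using sub S c by (auto simp: indep_def)
    consider "card c = 2" | "card c = 3" using near_regularD(2)[OF assms(1) c cA] by auto
    then show False
    proof cases
      case 1
      then obtain b where b: "c = {v, b}" "b \<noteq> v" using v by (auto simp: card_2_iff)
      then have "b \<in> nb A C v" using c cA by (auto simp: nb_def)
      then show False using sub S b by (auto simp: indep_def)
    next
      case 2
      then have "c - {v} \<in> lk A C v"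
        using c cA v by (auto simp: lk_def insert_absorb card_Diff_singleton_if)
      then show False using sub S by (auto simp: indep_def)
    qed
  qed
  then show "S \<in> ?L" using S by (auto simp: indep_def contr_def)
qed

text \<open>For a common element \<open>b\<close>, the pair \<open>{v, b}\<close> and the triple at
  \<open>v\<close> through \<open>b\<close> would share two elements, against linearity.\<close>

lemma lk_nb_disjoint:
  assumes "near_regular m k A C" "v \<in> A" "t \<in> lk A C v"
  shows "t \<inter> nb A C v = {}"
proof (rule ccontr)
  assume "t \<inter> nb A C v \<noteq> {}"
  then obtain b where b: "b \<in> t" "b \<in> A" "b \<noteq> v" "{v, b} \<in> C" by (auto simp: nb_def)
  have t: "finite t" "card t = 2" "v \<notin> t" "t \<subseteq> A" "insert v t \<in> C"
    using assms near_regularD(1)[OF assms(1)] by (auto simp: lk_def intro: finite_subset)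
  have "insert v t = {v, b}"
  proof (rule near_regularD(3)[OF assms(1)])
    have "insert v t \<inter> {v, b} = {v, b}" using b by auto
    then show "2 \<le> card (insert v t \<inter> {v, b})" using b by simp
  qed (use assms b t in auto)
  then have "card (insert v t) = 2" using b by simp
  then show False using t by simp
qed

lemma lk_Diff_nb:
  assumes "near_regular m k A C" "v \<in> A"
  shows "lk (A - nb A C v) C v = lk A C v"
  using lk_nb_disjoint[OF assms] by (auto simp: lk_def)

text \<open>To the original error \<open>k\<close>, deleting the at most \<open>k\<close> neighbours
  adds \<open>k\<close>, and passing to the link adds one.\<close>

lemma near_regular_cond:
  assumes "near_regular m k A C" "v \<in> A" "T \<subseteq> lk A C v"
  shows "near_regular m (2 * k + 1) (A - nb A C v - {v}) (C \<union> T)"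
proof -
  have "near_regular m (k + card (nb A C v)) (A - nb A C v) C"
    using assms near_regularD(1)[OF assms(1)] by (intro near_regular_del_set) auto
  then have "near_regular m (Suc (k + card (nb A C v))) (A - nb A C v - {v}) (C \<union> T)"
    by (rule near_regular_link) (use assms lk_Diff_nb[OF assms(1,2)] in \<open>auto simp: nb_def\<close>)
  then show ?thesis
    by (rule near_regular_mono) (use near_regularD(4)[OF assms(1,2)] in simp)
qed

text \<open>Combines \<open>ipoly_insert_pair\<close> with \<open>indep_contr\<close>, so that both
  ratios belong to the class with error \<open>2 * k + 1\<close>. Quantifying over \<open>P\<close>
  transfers any uniform property of that class to \<open>r\<close> and \<open>r'\<close> without
  naming the systems they come from.\<close>

lemma pair_factor:
  fixes A :: "'a set"
  assumes near: "near_regular m k A C" and t: "t \<subseteq> A" "card t = 2" "t \<notin> C" and l: "0 \<le> l"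
  obtains r r' where "ipoly A (insert t C) l = ipoly A C l * (1 - r / (1 + r) * (r' / (1 + r')))"
    and "\<And>P. (\<And>A C (v :: 'a). near_regular m (2 * k + 1) A C \<Longrightarrow> v \<in> A \<Longrightarrow> P (occ_ratio A C l v)) \<Longrightarrow> P r \<and> P r'"
proof -
  obtain a b where ab: "t = {a, b}" "a \<noteq> b" using t by (auto simp: card_2_iff)
  note D = near_regularD[OF near]
  have a: "a \<in> A" and b: "b \<in> A" using ab t by auto
  have "{a} \<notin> C" using D(2)[of "{a}"] a by auto
  let ?A' = "A - nb A C a - {a}" and ?C' = "C \<union> lk A C a"
  \<comment> \<open>\<open>b\<close> survives the deletion of the neighbours of \<open>a\<close>
    because \<open>t\<close> is not yet a constraint.\<close>
  have b': "b \<in> ?A'" using ab t b by (auto simp: nb_def)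
  have eq: "occ_ratio (A - {a}) (contr C a) l b = occ_ratio ?A' ?C' l b"
    unfolding occ_ratio_def indep_contr[OF near a] ..
  show ?thesis
  proof (rule that)
    show "ipoly A (insert t C) l = ipoly A C l * (1 - occ_ratio A C l a / (1 + occ_ratio A C l a) *
      (occ_ratio ?A' ?C' l b / (1 + occ_ratio ?A' ?C' l b)))"
      unfolding ab eq[symmetric]
      by (rule ipoly_insert_pair) (use a b ab D \<open>{a} \<notin> C\<close> l in auto)
  next
    fix P assume P: "\<And>A C (v :: 'a). near_regular m (2 * k + 1) A C \<Longrightarrow> v \<in> A \<Longrightarrow> P (occ_ratio A C l v)"
    show "P (occ_ratio A C l a) \<and> P (occ_ratio ?A' ?C' l b)"
      using P[OF _ a] near_regular_mono[OF near, of "2 * k + 1"]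
        P[OF near_regular_cond[OF near a order_refl] b'] by simp
  qed
qed

text \<open>Each added pair contributes a factor one minus a product of two occupation
  probabilities, both between \<open>L / (1 + L)\<close> and \<open>U\<close>. The intermediate
  systems have error \<open>2 * k + 1\<close>, which \<open>pair_factor\<close> raises to
  \<open>4 * k + 3\<close>.\<close>

lemma ipoly_add_link:
  fixes A :: "'a set"
  assumes near: "near_regular m k A C" and v: "v \<in> A" and l: "0 \<le> l" and T: "T \<subseteq> lk A C v"
    and bound: "\<And>A C (v :: 'a). near_regular m (4 * k + 3) A C \<Longrightarrow> v \<in> A \<Longrightarrow>
      L \<le> occ_ratio A C l v \<and> occ_ratio A C l v \<le> U"
    and "0 \<le> L" "U \<le> 1"
  defines "B \<equiv> A - nb A C v - {v}"
  shows "ipoly B C l * (1 - U\<^sup>2) ^ card T \<le> ipoly B (C \<union> T) l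
    \<and> ipoly B (C \<union> T) l \<le> ipoly B C l * (1 - (L / (1 + L))\<^sup>2) ^ card T"
proof -
  have fin: "finite T" using T near_regularD(1)[OF near] by (metis finite_lk finite_subset)
  then show ?thesis using T
  proof (induction T rule: finite_induct)
    case (insert t T)
    have good: "near_regular m (2 * k + 1) B (C \<union> T)"
      unfolding B_def by (rule near_regular_cond) (use near v insert in auto)
    have t: "t \<subseteq> B" "card t = 2"
      using insert lk_nb_disjoint[OF near v, of t] by (auto simp: B_def lk_def)
    \<comment> \<open>As a constraint, \<open>t\<close> would share two elements with the triple
      \<open>insert v t\<close>.\<close>
    have "t \<notin> C"
    proof
      assume "t \<in> C"
      moreover have it: "insert v t \<in> C" "v \<notin> t" "t \<subseteq> A" using insert by (auto simp: lk_def)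
      moreover have "finite t" using t(2) card.infinite by fastforce
      moreover have "insert v t \<inter> t = t" by auto
      ultimately have "insert v t = t"
        using v t by (intro near_regularD(3)[OF near]) auto
      then show False using it by auto
    qed
    then have t': "t \<notin> C \<union> T" using insert by auto
    obtain r r' where
      eq: "ipoly B (insert t (C \<union> T)) l = ipoly B (C \<union> T) l * (1 - r / (1 + r) * (r' / (1 + r')))"
      and rr: "\<And>P. (\<And>A C (v :: 'a). near_regular m (2 * (2 * k + 1) + 1) A C \<Longrightarrow> v \<in> A \<Longrightarrow>
            P (occ_ratio A C l v)) \<Longrightarrow> P r \<and> P r'"
      using pair_factor[OF good t t' l] by blast
    have "2 * (2 * k + 1) + 1 = 4 * k + 3" by simp
    then have r: "L \<le> r \<and> r \<le> U" "L \<le> r' \<and> r' \<le> U"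
      using rr[of "\<lambda>r. L \<le> r \<and> r \<le> U", OF bound] by metis+
    \<comment> \<open>Passes from odds to probabilities: \<open>x / (1 + x)\<close> is increasing
      and at most \<open>x\<close>.\<close>
    have mono: "L / (1 + L) \<le> x / (1 + x) \<and> x / (1 + x) \<le> U \<and> 0 \<le> x / (1 + x)"
      if "L \<le> x \<and> x \<le> U" for x
    proof -
      have "0 \<le> U * x" using that \<open>0 \<le> L\<close> by (intro mult_nonneg_nonneg) auto
      with that have "x \<le> U * (1 + x)" by (simp add: algebra_simps)
      then show ?thesis using that \<open>0 \<le> L\<close> by (auto simp: divide_simps) (simp_all add: algebra_simps)
    qed
    let ?q = "r / (1 + r) * (r' / (1 + r'))"
    have q: "(L / (1 + L))\<^sup>2 \<le> ?q" "?q \<le> U\<^sup>2"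
      unfolding power2_eq_square
      by (rule mult_mono; use mono[OF r(1)] mono[OF r(2)] \<open>0 \<le> L\<close> in simp)+
    have U: "0 \<le> U" "U\<^sup>2 \<le> 1" using r \<open>0 \<le> L\<close> \<open>U \<le> 1\<close> by (auto simp: power_le_one)
    have IH: "ipoly B C l * (1 - U\<^sup>2) ^ card T \<le> ipoly B (C \<union> T) l"
      "ipoly B (C \<union> T) l \<le> ipoly B C l * (1 - (L / (1 + L))\<^sup>2) ^ card T"
      using insert by auto
    have "ipoly B C l * (1 - U\<^sup>2) ^ card T * (1 - U\<^sup>2) \<le> ipoly B (C \<union> T) l * (1 - ?q)"
      using IH q U l by (intro mult_mono) (auto simp: ipoly_nonneg)
    moreover have "ipoly B (C \<union> T) l * (1 - ?q)
        \<le> ipoly B C l * (1 - (L / (1 + L))\<^sup>2) ^ card T * (1 - (L / (1 + L))\<^sup>2)"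
    proof (rule mult_mono)
      show "0 \<le> ipoly B C l * (1 - (L / (1 + L))\<^sup>2) ^ card T"
        using IH l ipoly_nonneg[of l B "C \<union> T"] by linarith
      show "0 \<le> 1 - ?q" using q U by linarith
    qed (use IH q in auto)
    ultimately show ?case using insert eq by (simp add: mult_ac)
  qed simp
qed

text \<open>By \<open>ipoly_occ_ratio\<close>, each deletion costs one plus a ratio;
  \<open>k'\<close> leaves room for the error to grow along the way.\<close>

lemma ipoly_del_set:
  fixes A :: "'a set"
  assumes near: "near_regular m k A C" and l: "0 \<le> l" and X: "finite X" "X \<subseteq> A" "k + card X \<le> k'"
    and bound: "\<And>A C (v :: 'a). near_regular m k' A C \<Longrightarrow> v \<in> A \<Longrightarrow> occ_ratio A C l v \<le> U"
    and "0 \<le> U"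
  shows "ipoly A C l \<le> ipoly (A - X) C l * (1 + U) ^ card X"
  using X
proof (induction X rule: finite_induct)
  case (insert x X)
  have good: "near_regular m (k + card X) (A - X) C" using near insert by (intro near_regular_del_set)
  have x: "x \<in> A - X" using insert by auto
  have "occ_ratio (A - X) C l x \<le> U"
    using insert by (intro bound[OF _ x] near_regular_mono[OF good]) simp
  then have "ipoly (A - X) C l \<le> ipoly (A - X - {x}) C l * (1 + U)"
    using near_regularD[OF good] l x
    by (subst ipoly_occ_ratio[of x]) (auto intro!: mult_left_mono ipoly_nonneg)
  then have "ipoly (A - X) C l * (1 + U) ^ card X \<le> ipoly (A - X - {x}) C l * (1 + U) * (1 + U) ^ card X"
    using \<open>0 \<le> U\<close> by (intro mult_right_mono) auto
  then show ?case using insert by (simp add: Diff_insert[of A x X] mult_ac)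
qed simp

text \<open>Assuming the bounds \<open>L\<close> and \<open>U\<close> for a whole class closed under conditioning replaces the
  computation tree of self-avoiding walks.\<close>

lemma occ_ratio_bounds:
  fixes A :: "'a set"
  assumes near: "near_regular m k A C" and v: "v \<in> A" and l: "0 \<le> l"
    and bound: "\<And>A C (v :: 'a). near_regular m (4 * k + 3) A C \<Longrightarrow> v \<in> A \<Longrightarrow>
      L \<le> occ_ratio A C l v \<and> occ_ratio A C l v \<le> U"
    and L: "0 \<le> L" and U: "U \<le> 1"
  shows "l * (1 - U\<^sup>2) ^ m / (1 + U) ^ k \<le> occ_ratio A C l v"
    and "occ_ratio A C l v \<le> l * (1 - (L / (1 + L))\<^sup>2) ^ (m - k)"
proof -
  note D = near_regularD[OF near]
  define B where "B = A - nb A C v - {v}"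
  have "L \<le> U" using bound[OF near_regular_mono[OF near, of "4 * k + 3"] v] by simp
  with L have U0: "0 \<le> U" by auto
  \<comment> \<open>The ratio \<open>l * y / z\<close> is split at \<open>w\<close>:
    \<open>y / w\<close> telescopes over between \<open>m - k\<close> and \<open>m\<close> link
    pairs, while \<open>z / w\<close> lies between 1 and \<open>(1 + U) ^ k\<close>, the cost of
    deleting the pair neighbours of \<open>v\<close>.\<close>
  define z where "z = ipoly (A - {v}) C l"
  define w where "w = ipoly B C l"
  define y where "y = ipoly B (C \<union> lk A C v) l"
  have zpos: "z \<ge> 1" "w \<ge> 1" unfolding z_def w_def B_def using D l by (auto intro!: ipoly_ge_1)
  have R: "occ_ratio A C l v = l * y / z"
    using v D(1) indep_contr[OF near v] by (simp add: occ_ratio_eq z_def y_def B_def ipoly_def)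
  have y: "w * (1 - U\<^sup>2) ^ card (lk A C v) \<le> y"
    "y \<le> w * (1 - (L / (1 + L))\<^sup>2) ^ card (lk A C v)"
    using ipoly_add_link[OF near v l order_refl bound L U] by (auto simp: y_def w_def B_def)
  have "w \<le> z" unfolding w_def z_def B_def using D(1) l by (intro ipoly_mono) (auto simp: indep_def)
  have B: "B = A - {v} - nb A C v" by (auto simp: B_def)
  have "z \<le> w * (1 + U) ^ card (nb A C v)"
    unfolding z_def w_def B
  proof (rule ipoly_del_set[OF near_regular_del[OF near] l, where k' = "4 * k + 3"])
    show "Suc k + card (nb A C v) \<le> 4 * k + 3" using D(4)[OF v] by simp
  qed (use D(1) bound U0 in \<open>auto simp: nb_def\<close>)
  also have "\<dots> \<le> w * (1 + U) ^ k"
    using zpos D(4)[OF v] U0 by (intro mult_left_mono power_increasing) auto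
  finally have zw: "z \<le> w * (1 + U) ^ k" .
  have U2: "0 \<le> 1 - U\<^sup>2" "1 - U\<^sup>2 \<le> 1" using U0 U by (auto simp: power_le_one)
  have "w * (1 - U\<^sup>2) ^ m \<le> y"
    using zpos by (intro order_trans[OF mult_left_mono[OF power_decreasing[OF D(5)[OF v] U2]] y(1)]) auto
  then have "w * (1 - U\<^sup>2) ^ m * (1 + U) ^ k \<le> y * (1 + U) ^ k"
    by (rule mult_right_mono) (use U0 in auto)
  moreover have "z * (1 - U\<^sup>2) ^ m \<le> w * (1 + U) ^ k * (1 - U\<^sup>2) ^ m"
    by (rule mult_right_mono[OF zw]) (use U2 in auto)
  ultimately have "z * (1 - U\<^sup>2) ^ m \<le> y * (1 + U) ^ k" by (simp add: mult_ac)
  then have "(1 - U\<^sup>2) ^ m / (1 + U) ^ k \<le> y / z"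
    using zpos U0 by (simp add: divide_simps mult_ac)
  then show "l * (1 - U\<^sup>2) ^ m / (1 + U) ^ k \<le> occ_ratio A C l v"
    unfolding R using mult_left_mono[OF _ l] by fastforce
  have L2: "0 \<le> 1 - (L / (1 + L))\<^sup>2" "1 - (L / (1 + L))\<^sup>2 \<le> 1"
    using L by (auto simp: power_le_one divide_simps)
  have "y \<le> w * (1 - (L / (1 + L))\<^sup>2) ^ (m - k)"
    using D(6)[OF v] zpos
    by (intro order_trans[OF y(2) mult_left_mono[OF power_decreasing[OF _ L2]]]) auto
  also have "\<dots> \<le> z * (1 - (L / (1 + L))\<^sup>2) ^ (m - k)"
    using \<open>w \<le> z\<close> L2 by (intro mult_right_mono) auto
  finally have "y / z \<le> (1 - (L / (1 + L))\<^sup>2) ^ (m - k)" using zpos by (simp add: divide_simps mult_ac)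
  then show "occ_ratio A C l v \<le> l * (1 - (L / (1 + L))\<^sup>2) ^ (m - k)"
    unfolding R using mult_left_mono[OF _ l] by fastforce
qed

subsection \<open>Asymptotic occupation ratios\<close>

text \<open>Uniform in the ground set and the constraints, with \<open>n\<close> as nominal degree.
  All \<open>k\<close> are treated together because a bound for \<open>k\<close> consumes one for
  \<open>4 * k + 3\<close>. The \<open>itself\<close> argument fixes the vertex type, which
  otherwise occurs only under quantifiers.\<close>

definition occ_upper :: "'a itself \<Rightarrow> (nat \<Rightarrow> real) \<Rightarrow> real \<Rightarrow> bool" where
  "occ_upper _ l b \<longleftrightarrow> (\<forall>k. \<forall>e>0. \<forall>\<^sub>F n in sequentially. \<forall>(A :: 'a set) C v.
     near_regular n k A C \<longrightarrow> v \<in> A \<longrightarrow> occ_ratio A C (l n) v \<le> (b + e) / sqrt (real n))"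

definition occ_lower :: "'a itself \<Rightarrow> (nat \<Rightarrow> real) \<Rightarrow> real \<Rightarrow> bool" where
  "occ_lower _ l a \<longleftrightarrow> (\<forall>k. \<forall>e>0. \<forall>\<^sub>F n in sequentially. \<forall>(A :: 'a set) C v.
     near_regular n k A C \<longrightarrow> v \<in> A \<longrightarrow> (a - e) / sqrt (real n) \<le> occ_ratio A C (l n) v)"

lemma near_regular_occ_ratio_le:
  "near_regular m k A C \<Longrightarrow> v \<in> A \<Longrightarrow> 0 \<le> l \<Longrightarrow> occ_ratio A C l v \<le> l"
  by (rule occ_ratio_le) (auto dest: near_regularD)

lemma occ_upper_trivial:
  assumes l: "\<And>n. 0 \<le> l n" and lim: "(\<lambda>n. l n * sqrt (real n)) \<longlonglongrightarrow> s"
  shows "occ_upper TYPE('a) l s"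
  unfolding occ_upper_def
proof (intro allI impI)
  fix k and e :: real assume "e > 0"
  then have "\<forall>\<^sub>F n in sequentially. l n * sqrt (real n) < s + e"
    using lim by (intro order_tendstoD) auto
  then show "\<forall>\<^sub>F n in sequentially. \<forall>(A :: 'a set) C v.
     near_regular n k A C \<longrightarrow> v \<in> A \<longrightarrow> occ_ratio A C (l n) v \<le> (s + e) / sqrt (real n)"
    using eventually_gt_at_top[of 0]
  proof eventually_elim
    case (elim n)
    then have "l n \<le> (s + e) / sqrt (real n)" by (simp add: field_simps)
    then show ?case by (intro allI impI order_trans[OF near_regular_occ_ratio_le[OF _ _ l]])
  qed
qed

text \<open>With \<open>U\<close> about \<open>b / sqrt n\<close>, the factor
  \<open>(1 - U\<^sup>2) ^ n\<close> tends to \<open>exp (- b\<^sup>2)\<close>, and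
  \<open>(1 + U) ^ k\<close> tends to 1 because \<open>k\<close> is fixed.\<close>

lemma occ_lower_step:
  assumes l: "\<And>n. 0 \<le> l n" and lim: "(\<lambda>n. l n * sqrt (real n)) \<longlonglongrightarrow> s"
    and b: "0 \<le> b" "occ_upper TYPE('a) l b"
  shows "occ_lower TYPE('a) l (s * exp (- b\<^sup>2))"
  unfolding occ_lower_def
proof (intro allI impI)
  fix k and e :: real assume e: "e > 0"
  \<comment> \<open>By continuity, a small enough slack \<open>d\<close> in the given upper bound
    costs less than \<open>e\<close> in the conclusion.\<close>
  have "((\<lambda>d. s * exp (- (b + d)\<^sup>2)) \<longlongrightarrow> s * exp (- (b + 0)\<^sup>2)) (at_right 0)"
    by (intro tendsto_intros)
  then have "\<forall>\<^sub>F d in at_right 0. s * exp (- (b + d)\<^sup>2) > s * exp (- b\<^sup>2) - e"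
    by (rule order_tendstoD) (use e in auto)
  then have "\<forall>\<^sub>F d in at_right 0. s * exp (- (b + d)\<^sup>2) > s * exp (- b\<^sup>2) - e \<and> 0 < d"
    using eventually_at_right_less by (rule eventually_conj)
  then obtain d where d: "s * exp (- (b + d)\<^sup>2) > s * exp (- b\<^sup>2) - e" "d > 0"
    using eventually_happens'[OF trivial_limit_at_right_real] by blast
  define U where "U n = (b + d) / sqrt (real n)" for n
  have U0: "U \<longlonglongrightarrow> 0" unfolding U_def by real_asymp
  have "(\<lambda>n. (1 + (- (b + d)\<^sup>2) / real n) ^ n) \<longlonglongrightarrow> exp (- (b + d)\<^sup>2)"
    by (rule tendsto_exp_limit_sequentially)
  then have "(\<lambda>n. (1 - (U n)\<^sup>2) ^ n) \<longlonglongrightarrow> exp (- (b + d)\<^sup>2)"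
    by (simp add: U_def power_divide)
  then have "(\<lambda>n. l n * sqrt (real n) * (1 - (U n)\<^sup>2) ^ n / (1 + U n) ^ k)
      \<longlonglongrightarrow> s * exp (- (b + d)\<^sup>2) / (1 + 0) ^ k"
    by (intro tendsto_intros lim U0) auto
  then have "\<forall>\<^sub>F n in sequentially. l n * sqrt (real n) * (1 - (U n)\<^sup>2) ^ n / (1 + U n) ^ k
      > s * exp (- b\<^sup>2) - e"
    by (rule order_tendstoD) (use d in auto)
  moreover have "\<forall>\<^sub>F n in sequentially. U n < 1" by (rule order_tendstoD[OF U0]) auto
  moreover have "\<forall>\<^sub>F n in sequentially. \<forall>(A :: 'a set) C v.
     near_regular n (4 * k + 3) A C \<longrightarrow> v \<in> A \<longrightarrow> occ_ratio A C (l n) v \<le> U n"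
    using b(2)[unfolded occ_upper_def, rule_format, OF d(2), of "4 * k + 3"] unfolding U_def .
  ultimately show "\<forall>\<^sub>F n in sequentially. \<forall>(A :: 'a set) C v.
     near_regular n k A C \<longrightarrow> v \<in> A \<longrightarrow> (s * exp (- b\<^sup>2) - e) / sqrt (real n) \<le> occ_ratio A C (l n) v"
    using eventually_gt_at_top[of 0]
  proof eventually_elim
    case (elim n)
    show ?case
    proof (intro allI impI)
      fix A :: "'a set" and C v assume A: "near_regular n k A C" "v \<in> A"
      have "l n * (1 - (U n)\<^sup>2) ^ n / (1 + U n) ^ k \<le> occ_ratio A C (l n) v"
        by (rule occ_ratio_bounds(1)[OF A l, of 0]) (use elim occ_ratio_nonneg[OF l] in auto)
      moreover have "(s * exp (- b\<^sup>2) - e) / sqrt (real n) \<le> l n * (1 - (U n)\<^sup>2) ^ n / (1 + U n) ^ k"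
        using elim by (simp add: pos_divide_le_eq mult_ac)
      ultimately show "(s * exp (- b\<^sup>2) - e) / sqrt (real n) \<le> occ_ratio A C (l n) v" by linarith
    qed
  qed
qed

text \<open>The mirror image of \<open>occ_lower_step\<close>, with exponent \<open>n - k\<close>.
  Positivity of \<open>a\<close> leaves room for a slack \<open>d < a\<close>, so that the lower
  bound fed into \<open>occ_ratio_bounds\<close> stays nonnegative.\<close>

lemma occ_upper_step:
  assumes l: "\<And>n. 0 \<le> l n" and lim: "(\<lambda>n. l n * sqrt (real n)) \<longlonglongrightarrow> s"
    and a: "0 < a" "occ_lower TYPE('a) l a"
  shows "occ_upper TYPE('a) l (s * exp (- a\<^sup>2))"
  unfolding occ_upper_def
proof (intro allI impI)
  fix k and e :: real assume e: "e > 0"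
  have "((\<lambda>d. s * exp (- (a - d)\<^sup>2)) \<longlongrightarrow> s * exp (- (a - 0)\<^sup>2)) (at_right 0)"
    by (intro tendsto_intros)
  then have "\<forall>\<^sub>F d in at_right 0. s * exp (- (a - d)\<^sup>2) < s * exp (- a\<^sup>2) + e"
    by (rule order_tendstoD) (use e in auto)
  moreover have "\<forall>\<^sub>F d in at_right 0. d \<in> {0<..<a}"
    using a by (intro eventually_at_right_real)
  ultimately have "\<forall>\<^sub>F d in at_right 0. s * exp (- (a - d)\<^sup>2) < s * exp (- a\<^sup>2) + e \<and> d \<in> {0<..<a}"
    by (rule eventually_conj)
  then obtain d where d: "s * exp (- (a - d)\<^sup>2) < s * exp (- a\<^sup>2) + e" "d > 0" "d < a"
    using eventually_happens'[OF trivial_limit_at_right_real] by auto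
  define \<alpha> where "\<alpha> = a - d"
  have \<alpha>: "\<alpha> > 0" using d by (simp add: \<alpha>_def)
  define L where "L n = \<alpha> / sqrt (real n)" for n
  have "(\<lambda>n. (real n - real k) * (L n / (1 + L n))\<^sup>2) \<longlonglongrightarrow> \<alpha>\<^sup>2"
    unfolding L_def using \<alpha> by real_asymp
  then have "(\<lambda>n. l n * sqrt (real n) * exp (- ((real n - real k) * (L n / (1 + L n))\<^sup>2)))
      \<longlonglongrightarrow> s * exp (- \<alpha>\<^sup>2)"
    by (intro tendsto_intros lim)
  then have "\<forall>\<^sub>F n in sequentially.
      l n * sqrt (real n) * exp (- ((real n - real k) * (L n / (1 + L n))\<^sup>2)) < s * exp (- a\<^sup>2) + e"
    by (rule order_tendstoD) (use d in \<open>auto simp: \<alpha>_def\<close>)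
  \<comment> \<open>\<open>l n\<close> itself will be the upper bound \<open>U\<close>, which has to
    be at most 1.\<close>
  moreover have "\<forall>\<^sub>F n in sequentially. l n < 1"
  proof (rule order_tendstoD)
    have "(\<lambda>n. (l n * sqrt (real n)) * (1 / sqrt (real n))) \<longlonglongrightarrow> s * 0"
      by (intro tendsto_mult lim) real_asymp
    moreover have "\<forall>\<^sub>F n in sequentially. (l n * sqrt (real n)) * (1 / sqrt (real n)) = l n"
      using eventually_gt_at_top[of 0] by eventually_elim simp
    ultimately show "l \<longlonglongrightarrow> 0" by (auto intro: Lim_transform_eventually)
  qed simp
  moreover have "\<forall>\<^sub>F n in sequentially. \<forall>(A :: 'a set) C v.
     near_regular n (4 * k + 3) A C \<longrightarrow> v \<in> A \<longrightarrow> L n \<le> occ_ratio A C (l n) v"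
    using a(2)[unfolded occ_lower_def, rule_format, OF d(2), of "4 * k + 3"] unfolding L_def \<alpha>_def .
  ultimately show "\<forall>\<^sub>F n in sequentially. \<forall>(A :: 'a set) C v.
     near_regular n k A C \<longrightarrow> v \<in> A \<longrightarrow> occ_ratio A C (l n) v \<le> (s * exp (- a\<^sup>2) + e) / sqrt (real n)"
    using eventually_gt_at_top[of 0] eventually_ge_at_top[of k]
  proof eventually_elim
    case (elim n)
    have L: "0 \<le> L n" using \<alpha> by (simp add: L_def)
    define q where "q = (L n / (1 + L n))\<^sup>2"
    have q: "q \<le> 1" using L by (auto simp: q_def intro!: power_le_one)
    \<comment> \<open>The inequality \<open>1 - q \<le> exp (- q)\<close> turns the power into an
      exponential whose limit is already known.\<close>
    have "(1 - q) ^ (n - k) \<le> exp (- q) ^ (n - k)"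
      using q exp_ge_add_one_self[of "- q"] by (intro power_mono) auto
    also have "\<dots> = exp (- ((real n - real k) * q))"
      using elim by (simp add: exp_of_nat_mult[symmetric] of_nat_diff)
    finally have q': "(1 - q) ^ (n - k) \<le> exp (- ((real n - real k) * q))" .
    show ?case
    proof (intro allI impI)
      fix A :: "'a set" and C v assume A: "near_regular n k A C" "v \<in> A"
      have "occ_ratio A C (l n) v \<le> l n * (1 - q) ^ (n - k)"
        unfolding q_def
        by (rule occ_ratio_bounds(2)[OF A l, where U = "l n"])
          (use elim l L in \<open>auto intro: near_regular_occ_ratio_le\<close>)
      also have "\<dots> \<le> l n * exp (- ((real n - real k) * q))"
        using q' l by (intro mult_left_mono) auto
      also have "\<dots> \<le> (s * exp (- a\<^sup>2) + e) / sqrt (real n)"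
        using elim by (simp add: pos_le_divide_eq mult_ac q_def)
      finally show "occ_ratio A C (l n) v \<le> (s * exp (- a\<^sup>2) + e) / sqrt (real n)" .
    qed
  qed
qed

section \<open>Contraction to the fixed point\<close>

lemma abs_exp_diff_le:
  fixes u v :: real
  assumes "u \<le> 0" "v \<le> 0"
  shows "\<bar>exp u - exp v\<bar> \<le> \<bar>u - v\<bar>"
proof -
  have *: "exp v - exp u \<le> v - u" if "u \<le> v" "v \<le> 0" for u v :: real
  proof -
    have "exp v - exp u = exp v * (1 - exp (u - v))" by (simp add: exp_diff right_diff_distrib)
    also have "\<dots> \<le> 1 * (v - u)"
    proof (rule mult_mono)
      show "1 - exp (u - v) \<le> v - u" using exp_ge_add_one_self[of "u - v"] by linarith
    qed (use that in auto)
    finally show ?thesis by simp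
  qed
  show ?thesis using *[of u v] *[of v u] assms by (cases "u \<le> v") auto
qed

text \<open>Starting from the trivial upper bound \<open>s\<close>, even iterates of the decreasing
  map \<open>F\<close> bound the scaled ratios from above and odd ones from below; both tend to the
  fixed point \<open>x\<close>.\<close>

lemma occ_ratio_asymp:
  assumes l: "\<And>n. 0 \<le> l n" and lim: "(\<lambda>n. l n * sqrt (real n)) \<longlonglongrightarrow> s"
    and s: "0 < s" "2 * s\<^sup>2 < 1" and x: "0 \<le> x" "x = s * exp (- x\<^sup>2)" and e: "0 < e"
  shows "\<forall>\<^sub>F n in sequentially. \<forall>(A :: 'a set) C v.
     near_regular n k A C \<longrightarrow> v \<in> A \<longrightarrow> \<bar>occ_ratio A C (l n) v * sqrt (real n) - x\<bar> \<le> e"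
proof -
  define F where "F y = s * exp (- y\<^sup>2)" for y
  have F: "0 < F y" "F y \<le> s" for y using s by (auto simp: F_def mult_le_cancel_left1)
  have xs: "x \<le> s" using x F(2)[of x] by (simp add: F_def)
  \<comment> \<open>\<open>s\<close> in front of the exponential and
    \<open>y + x \<le> 2 * s\<close> from the difference of squares give the Lipschitz constant
    \<open>2 * s\<^sup>2\<close>.\<close>
  have contraction: "\<bar>F y - x\<bar> \<le> 2 * s\<^sup>2 * \<bar>y - x\<bar>" if y: "0 \<le> y" "y \<le> s" for y
  proof -
    have "\<bar>F y - x\<bar> = \<bar>s * (exp (- y\<^sup>2) - exp (- x\<^sup>2))\<bar>"
      using x by (simp add: F_def right_diff_distrib)
    also have "\<dots> = s * \<bar>exp (- y\<^sup>2) - exp (- x\<^sup>2)\<bar>" using s by (simp add: abs_mult)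
    also have "\<dots> \<le> s * \<bar>- y\<^sup>2 - - x\<^sup>2\<bar>"
      using s by (intro mult_left_mono abs_exp_diff_le) auto
    also have "\<bar>- y\<^sup>2 - - x\<^sup>2\<bar> = \<bar>y - x\<bar> * (y + x)"
    proof -
      have "- y\<^sup>2 - - x\<^sup>2 = - ((y - x) * (y + x))" by (simp add: power2_eq_square algebra_simps)
      then show ?thesis using x y by (simp add: abs_mult)
    qed
    also have "s * (\<bar>y - x\<bar> * (y + x)) \<le> s * (\<bar>y - x\<bar> * (2 * s))"
      using s x xs y by (intro mult_left_mono) auto
    finally show ?thesis by (simp add: power2_eq_square mult_ac)
  qed
  have range: "0 < (F ^^ j) s \<and> (F ^^ j) s \<le> s" for j using F s by (cases j) auto
  have dist: "\<bar>(F ^^ j) s - x\<bar> \<le> (2 * s\<^sup>2) ^ j * s" for j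
  proof (induction j)
    case 0
    then show ?case using x xs by auto
  next
    case (Suc j)
    have "\<bar>(F ^^ Suc j) s - x\<bar> \<le> 2 * s\<^sup>2 * \<bar>(F ^^ j) s - x\<bar>"
      using contraction range[of j] by (simp add: less_imp_le)
    also have "\<dots> \<le> 2 * s\<^sup>2 * ((2 * s\<^sup>2) ^ j * s)" using Suc by (intro mult_left_mono) auto
    finally show ?case by (simp add: mult_ac)
  qed
  have "(\<lambda>j. (2 * s\<^sup>2) ^ j * s) \<longlonglongrightarrow> 0 * s"
    using s by (intro tendsto_intros LIMSEQ_realpow_zero) auto
  then have "(\<lambda>j. (2 * s\<^sup>2) ^ j * s) \<longlonglongrightarrow> 0" by simp
  then have "(\<lambda>j. (F ^^ j) s - x) \<longlonglongrightarrow> 0"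
    by (rule Lim_null_comparison[rotated]) (simp only: real_norm_def dist eventually_True)
  from tendstoD[OF this, of "e / 2"] have "\<forall>\<^sub>F j in sequentially. \<bar>(F ^^ j) s - x\<bar> < e / 2"
    using e by (simp add: dist_real_def)
  then obtain J where J: "\<And>j. j \<ge> J \<Longrightarrow> \<bar>(F ^^ j) s - x\<bar> < e / 2"
    by (auto simp: eventually_sequentially)
  have upper: "occ_upper TYPE('a) l ((F ^^ (2 * j)) s)" for j
  proof (induction j)
    case 0
    show ?case using occ_upper_trivial[OF l lim] by simp
  next
    case (Suc j)
    have "occ_lower TYPE('a) l (F ((F ^^ (2 * j)) s))"
      unfolding F_def[of "(F ^^ (2 * j)) s"] using range[of "2 * j"]
      by (intro occ_lower_step[OF l lim _ Suc]) auto
    then have "occ_upper TYPE('a) l (F (F ((F ^^ (2 * j)) s)))"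
      unfolding F_def[of "F ((F ^^ (2 * j)) s)"]
      by (intro occ_upper_step[OF l lim]) (auto simp: F(1))
    then show ?case by simp
  qed
  have lower: "occ_lower TYPE('a) l (F ((F ^^ (2 * J)) s))"
    unfolding F_def[of "(F ^^ (2 * J)) s"] using range[of "2 * J"]
    by (intro occ_lower_step[OF l lim _ upper]) auto
  have "\<bar>(F ^^ (2 * J)) s - x\<bar> < e / 2" using J[of "2 * J"] by simp
  moreover have "\<bar>F ((F ^^ (2 * J)) s) - x\<bar> < e / 2" using J[of "Suc (2 * J)"] by simp
  ultimately have close: "(F ^^ (2 * J)) s < x + e / 2" "F ((F ^^ (2 * J)) s) > x - e / 2"
    by linarith+
  have "\<forall>\<^sub>F n in sequentially. \<forall>(A :: 'a set) C v. near_regular n k A C \<longrightarrow> v \<in> A \<longrightarrow>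
      occ_ratio A C (l n) v \<le> ((F ^^ (2 * J)) s + e / 2) / sqrt (real n)"
    using upper[of J, unfolded occ_upper_def, rule_format, of "e / 2" k] e by simp
  moreover have "\<forall>\<^sub>F n in sequentially. \<forall>(A :: 'a set) C v. near_regular n k A C \<longrightarrow> v \<in> A \<longrightarrow>
      (F ((F ^^ (2 * J)) s) - e / 2) / sqrt (real n) \<le> occ_ratio A C (l n) v"
    using lower[unfolded occ_lower_def, rule_format, of "e / 2" k] e by simp
  ultimately show ?thesis using eventually_gt_at_top[of 0]
  proof eventually_elim
    case (elim n)
    show ?case
    proof (intro allI impI)
      fix A :: "'a set" and C v assume A: "near_regular n k A C" "v \<in> A"
      have "occ_ratio A C (l n) v * sqrt (real n) \<le> (F ^^ (2 * J)) s + e / 2"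
        "F ((F ^^ (2 * J)) s) - e / 2 \<le> occ_ratio A C (l n) v * sqrt (real n)"
        using elim A by (auto simp: pos_le_divide_eq pos_divide_le_eq)
      then show "\<bar>occ_ratio A C (l n) v * sqrt (real n) - x\<bar> \<le> e" using close by linarith
    qed
  qed
qed

subsection \<open>The logarithmic derivative\<close>

text \<open>Double counting of the pairs of an independent set and one of its elements
  \<open>v\<close>: the factor \<open>card S\<close> becomes a sum over \<open>v\<close>, and the
  sets through \<open>v\<close> are counted by the contracted system.\<close>

lemma has_real_derivative_ipoly:
  assumes "finite A"
  shows "(ipoly A C has_real_derivative (\<Sum>v\<in>A. ipoly (A - {v}) (contr C v) l)) (at l)"
proof -
  have "(\<Sum>v\<in>A. ipoly (A - {v}) (contr C v) l)
      = (\<Sum>v\<in>A. \<Sum>S | S \<in> indep A C \<and> v \<in> S. l ^ (card S - 1))"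
    using sum_indep_card_mem[OF _ assms, where f = "\<lambda>k. l ^ (k - 1)"]
    by (intro sum.cong) (simp_all add: ipoly_def)
  also have "\<dots> = (\<Sum>S\<in>indep A C. \<Sum>v | v \<in> A \<and> v \<in> S. l ^ (card S - 1))"
    using assms by (intro sum.swap_restrict) auto
  also have "\<dots> = (\<Sum>S\<in>indep A C. real (card S) * l ^ (card S - 1))"
  proof (rule sum.cong)
    fix S assume "S \<in> indep A C"
    then have "{v. v \<in> A \<and> v \<in> S} = S" by (auto simp: indep_def)
    then show "(\<Sum>v | v \<in> A \<and> v \<in> S. l ^ (card S - 1)) = real (card S) * l ^ (card S - 1)" by simp
  qed simp
  finally have eq: "(\<Sum>v\<in>A. ipoly (A - {v}) (contr C v) l)
      = (\<Sum>S\<in>indep A C. real (card S) * l ^ (card S - 1))" .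
  have "((\<lambda>l. \<Sum>S\<in>indep A C. l ^ card S) has_real_derivative
      (\<Sum>S\<in>indep A C. real (card S) * l ^ (card S - 1))) (at l)"
    by (auto intro!: derivative_eq_intros)
  moreover have "ipoly A C = (\<lambda>l. \<Sum>S\<in>indep A C. l ^ card S)" by (rule ext) (rule ipoly_def)
  ultimately show ?thesis unfolding eq by simp
qed

text \<open>The occupation probability of \<open>v\<close> divided by \<open>l\<close>, in a form
  that is meaningful at \<open>l = 0\<close>, where the integration starts.\<close>

definition occ_prob_ratio :: "'a set \<Rightarrow> 'a set set \<Rightarrow> real \<Rightarrow> 'a \<Rightarrow> real" where
  "occ_prob_ratio A C l v = ipoly (A - {v}) (contr C v) l / ipoly A C l"

lemma has_real_derivative_ln_ipoly:
  assumes "finite A" "{} \<notin> C" "0 \<le> l"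
  shows "((\<lambda>l. ln (ipoly A C l)) has_real_derivative (\<Sum>v\<in>A. occ_prob_ratio A C l v)) (at l)"
  using ipoly_ge_1[of A l C] assms
  by (auto intro!: derivative_eq_intros has_real_derivative_ipoly
      simp: occ_prob_ratio_def sum_divide_distrib)

lemma occ_prob_ratio_bounds:
  assumes "finite A" "{} \<notin> C" "0 \<le> l" "v \<in> A"
  shows "0 \<le> occ_prob_ratio A C l v" "occ_prob_ratio A C l v \<le> 1"
proof -
  have "ipoly (A - {v}) (contr C v) l \<le> ipoly A C l"
    using assms by (intro ipoly_mono) (auto simp: indep_def contr_def)
  then show "0 \<le> occ_prob_ratio A C l v" "occ_prob_ratio A C l v \<le> 1"
    using ipoly_ge_1[of A l C] assms by (auto simp: occ_prob_ratio_def ipoly_nonneg)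
qed

lemma occ_prob_ratio_eq:
  assumes "finite A" "{} \<notin> C" "0 < l" "v \<in> A"
  shows "occ_prob_ratio A C l v = occ_ratio A C l v / (1 + occ_ratio A C l v) / l"
proof -
  let ?P = "ipoly (A - {v}) C l"
  have P: "1 \<le> ?P" using assms by (intro ipoly_ge_1) auto
  have "ipoly A C l = ?P * (1 + occ_ratio A C l v)" using assms by (intro ipoly_occ_ratio) auto
  moreover have "ipoly (A - {v}) (contr C v) l = ?P * (occ_ratio A C l v / l)"
    using assms P by (simp add: occ_ratio_eq)
  ultimately show ?thesis using P by (simp add: occ_prob_ratio_def)
qed

lemma ipoly_0: "finite A \<Longrightarrow> {} \<notin> C \<Longrightarrow> ipoly A C 0 = 1"
proof -
  assume A: "finite A" "{} \<notin> C"
  have "ipoly A C 0 = (\<Sum>S\<in>indep A C. if S = {} then 1 else 0)"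
    unfolding ipoly_def using A by (intro sum.cong) (auto simp: indep_def power_0_left dest: finite_subset)
  also have "\<dots> = 1" using A by (simp add: sum.delta) (auto simp: indep_def)
  finally show ?thesis .
qed

subsection \<open>The triangle hypergraph\<close>

definition pairs :: "'a set \<Rightarrow> 'a set set" where
  "pairs T = {e. e \<subseteq> T \<and> card e = 2}"

definition triangle_edges :: "nat \<Rightarrow> nat set set set" where
  "triangle_edges n = pairs ` {T. T \<subseteq> {..<n} \<and> card T = 3}"

lemma possible_edges_eq_pairs: "possible_edges n = pairs {..<n}"
  by (simp add: possible_edges_def pairs_def)

lemma card_pairs: "finite T \<Longrightarrow> card (pairs T) = card T choose 2"
  unfolding pairs_def by (rule n_subsets)

lemma pairs_Int: "pairs S \<inter> pairs T = pairs (S \<inter> T)"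
  by (auto simp: pairs_def)

lemma Union_pairs:
  assumes "card T = 3"
  shows "\<Union> (pairs T) = T"
proof -
  obtain x y z where T: "T = {x, y, z}" "x \<noteq> y" "y \<noteq> z" "x \<noteq> z"
    using assms by (auto simp: card_3_iff)
  then have "{x, y} \<in> pairs T" "{x, z} \<in> pairs T" by (auto simp: pairs_def)
  then have "{x, y} \<union> {x, z} \<subseteq> \<Union> (pairs T)" by blast
  moreover have "\<Union> (pairs T) \<subseteq> T" by (auto simp: pairs_def)
  ultimately show ?thesis using T(1) by blast
qed

text \<open>Triangles on the edge \<open>v\<close> correspond to their third vertex
  \<open>w\<close>; the map is injective because \<open>Union_pairs\<close> recovers
  \<open>insert w v\<close> from the edges.\<close>

lemma lk_triangle_edges:
  assumes v: "v \<in> possible_edges n"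
  shows "card (lk (possible_edges n) (triangle_edges n) v) = n - 2"
proof -
  let ?f = "\<lambda>w. pairs (insert w v) - {v}"
  have v': "v \<subseteq> {..<n}" "card v = 2" "finite v"
    using v by (auto simp: possible_edges_def intro: finite_subset)
  have T: "card (insert w v) = 3" "insert w v \<subseteq> {..<n}" "v \<in> pairs (insert w v)"
    if "w \<in> {..<n} - v" for w
    using that v' by (auto simp: pairs_def)
  have "lk (possible_edges n) (triangle_edges n) v = ?f ` ({..<n} - v)"
  proof (intro equalityI subsetI)
    fix t assume t: "t \<in> lk (possible_edges n) (triangle_edges n) v"
    then obtain S where S: "insert v t = pairs S" "S \<subseteq> {..<n}" "card S = 3" "v \<notin> t"
      by (auto simp: lk_def triangle_edges_def)
    have "finite S" using S finite_subset by blast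
    have vS: "v \<subseteq> S" using S(1) by (auto simp: pairs_def)
    have "card (S - v) = 1" using vS v' S by (simp add: card_Diff_subset)
    then obtain w where "S - v = {w}" by (auto simp: card_1_singleton_iff)
    then have w: "S = insert w v" "w \<notin> v" using vS by auto
    then have "t = ?f w" using S by auto
    then show "t \<in> ?f ` ({..<n} - v)" using w S by auto
  next
    fix t assume "t \<in> ?f ` ({..<n} - v)"
    then obtain w where w: "w \<in> {..<n} - v" "t = ?f w" by auto
    have "card (pairs (insert w v)) = 3"
      using T[OF w(1)] v' by (simp add: card_pairs numeral_eq_Suc)
    then have "card t = 2" using w T[OF w(1)] by (simp add: card_Diff_singleton_if)
    moreover have "insert v t = pairs (insert w v)" using w T[OF w(1)] by auto
    moreover have "t \<subseteq> possible_edges n" using w T[OF w(1)] by (auto simp: pairs_def possible_edges_def)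
    ultimately show "t \<in> lk (possible_edges n) (triangle_edges n) v"
      using w T[OF w(1)] by (auto simp: lk_def triangle_edges_def)
  qed
  moreover have "inj_on ?f ({..<n} - v)"
  proof (rule inj_onI)
    fix w w' assume w: "w \<in> {..<n} - v" "w' \<in> {..<n} - v" and eq: "?f w = ?f w'"
    have "pairs (insert w v) = pairs (insert w' v)"
      using T(3)[OF w(1)] T(3)[OF w(2)] eq by (metis insert_Diff)
    then have "insert w v = insert w' v"
      using Union_pairs T(1)[OF w(1)] T(1)[OF w(2)] by metis
    then show "w = w'" using w by auto
  qed
  ultimately show ?thesis using v' by (simp add: card_image card_Diff_subset)
qed

lemma card_triangle_edges: "c \<in> triangle_edges n \<Longrightarrow> card c = 3"
  by (auto simp: triangle_edges_def card_pairs numeral_eq_Suc intro!: trans[OF card_pairs]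
      dest: finite_subset)

text \<open>Distinct vertex triples share at most two vertices, hence at most one edge. The degree
  \<open>n - 2\<close> is read as nominal degree \<open>n\<close> with deficit 2, which is also
  correct for truncated subtraction.\<close>

lemma near_regular_triangle_edges: "near_regular n 2 (possible_edges n) (triangle_edges n)"
  unfolding near_regular_def
proof (intro conjI ballI impI)
  fix c d assume "c \<in> triangle_edges n" "d \<in> triangle_edges n" "c \<noteq> d"
  then obtain S T where S: "c = pairs S" "card S = 3" "finite S" and T: "d = pairs T" "card T = 3" "finite T"
    by (auto simp: triangle_edges_def dest: finite_subset)
  then have "S \<noteq> T" using \<open>c \<noteq> d\<close> by auto
  have "card (S \<inter> T) \<noteq> 3"
  proof
    assume "card (S \<inter> T) = 3"
    then have "S \<inter> T = S" "S \<inter> T = T" 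
      using S T by (metis Int_lower1 card_subset_eq, metis Int_lower2 card_subset_eq)
    then show False using \<open>S \<noteq> T\<close> by auto
  qed
  moreover have "card (S \<inter> T) \<le> 3" using card_mono[of S "S \<inter> T"] S by auto
  ultimately have "card (S \<inter> T) \<le> 2" by auto
  then have "card (S \<inter> T) choose 2 \<le> 2 choose 2" by (rule binomial_right_mono)
  then show "card (c \<inter> d) \<le> 1" using S T by (simp add: pairs_Int card_pairs)
next
  fix v assume v: "v \<in> possible_edges n"
  have "{v, b} \<notin> triangle_edges n" for b
    using card_triangle_edges[of "{v, b}" n] by (auto simp: card_insert_if split: if_splits)
  then show "card (nb (possible_edges n) (triangle_edges n) v) \<le> 2" by (simp add: nb_def)
  show "card (lk (possible_edges n) (triangle_edges n) v) \<le> n"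
    "n \<le> card (lk (possible_edges n) (triangle_edges n) v) + 2"
    by (simp_all add: lk_triangle_edges[OF v])
qed (auto dest: card_triangle_edges)

section \<open>The triangle-free probability as an independence polynomial\<close>

lemma num_triangles_eq_0_iff:
  assumes "E \<subseteq> possible_edges n"
  shows "num_triangles n E = 0 \<longleftrightarrow> E \<in> indep (possible_edges n) (triangle_edges n)"
proof -
  \<comment> \<open>Finiteness is what makes cardinality 0 mean that there is no triangle.\<close>
  have "finite (triangles n E)"
    by (rule finite_subset[of _ "Pow {..<n}"]) (auto simp: triangles_def)
  moreover have "(\<forall>u\<in>T. \<forall>v\<in>T. u \<noteq> v \<longrightarrow> {u, v} \<in> E) \<longleftrightarrow> pairs T \<subseteq> E" for T
  proof (intro iffI ballI impI)
    show "pairs T \<subseteq> E" if "\<forall>u\<in>T. \<forall>v\<in>T. u \<noteq> v \<longrightarrow> {u, v} \<in> E"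
      using that by (auto simp: pairs_def card_2_iff)
    show "{u, v} \<in> E" if "pairs T \<subseteq> E" "u \<in> T" "v \<in> T" "u \<noteq> v" for u v
      by (rule subsetD[OF that(1)]) (use that in \<open>simp add: pairs_def\<close>)
  qed
  ultimately show ?thesis
    using assms by (auto simp: num_triangles_def triangles_def indep_def triangle_edges_def)
qed

lemma pmf_erdos_renyi:
  assumes p: "0 \<le> p" "p \<le> 1" and E: "E \<subseteq> possible_edges n"
  shows "pmf (erdos_renyi n p) E = p ^ card E * (1 - p) ^ (card (possible_edges n) - card E)"
proof -
  let ?V = "possible_edges n"
  let ?M = "Pi_pmf ?V False (\<lambda>_. bernoulli_pmf p)"
  have "pmf (erdos_renyi n p) E = measure_pmf.prob ?M ((\<lambda>f. {e \<in> ?V. f e}) -` {E})"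
    by (simp add: erdos_renyi_def pmf_map)
  \<comment> \<open>The preimage also contains functions that are true somewhere outside
    \<open>?V\<close>; these have mass 0 because the default value there is
    \<open>False\<close>.\<close>
  also have "\<dots> = measure_pmf.prob ?M {\<lambda>e. e \<in> E}"
  proof (rule measure_prob_cong_0)
    fix f assume f: "f \<in> (\<lambda>f. {e \<in> ?V. f e}) -` {E} - {\<lambda>e. e \<in> E}"
    then obtain e where "f e \<noteq> (e \<in> E)" by (auto simp: fun_eq_iff)
    with f E have "e \<notin> ?V \<and> f e \<noteq> False" by auto
    then show "pmf ?M f = 0" by (intro pmf_Pi_outside) auto
  qed (use E in auto)
  also have "\<dots> = (\<Prod>e\<in>?V. if e \<in> E then p else 1 - p)"
    using p E by (subst measure_pmf_single, subst pmf_Pi') (auto intro!: prod.cong)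
  also have "\<dots> = p ^ card E * (1 - p) ^ card (?V - E)"
    using E by (simp add: prod.If_cases Int_absorb1 Int_absorb2 Diff_eq[symmetric])
  finally show ?thesis using E by (simp add: card_Diff_subset finite_subset)
qed

lemma prob_triangle_free:
  assumes p: "0 \<le> p" "p < 1"
  shows "measure_pmf.prob (erdos_renyi n p) {E. num_triangles n E = 0}
    = (1 - p) ^ card (possible_edges n) * ipoly (possible_edges n) (triangle_edges n) (p / (1 - p))"
proof -
  let ?V = "possible_edges n" and ?I = "indep (possible_edges n) (triangle_edges n)"
  have sub: "E \<subseteq> ?V" if "E \<in> set_pmf (erdos_renyi n p)" for E
    using that by (auto simp: erdos_renyi_def)
  have "measure_pmf.prob (erdos_renyi n p) {E. num_triangles n E = 0} = measure_pmf.prob (erdos_renyi n p) ?I"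
  proof (rule measure_prob_cong_0)
    fix E assume "E \<in> {E. num_triangles n E = 0} - ?I"
    then show "pmf (erdos_renyi n p) E = 0" 
      using sub[of E] num_triangles_eq_0_iff[of E n] by (auto simp: set_pmf_iff)
  next
    fix E assume E: "E \<in> ?I - {E. num_triangles n E = 0}"
    then have "E \<subseteq> ?V" by (auto simp: indep_def)
    then show "pmf (erdos_renyi n p) E = 0" using num_triangles_eq_0_iff[of E n] E by blast
  qed
  also have "\<dots> = (\<Sum>E\<in>?I. pmf (erdos_renyi n p) E)" by (rule measure_measure_pmf_finite) simp
  also have "\<dots> = (\<Sum>E\<in>?I. (1 - p) ^ card ?V * (p / (1 - p)) ^ card E)"
  proof (rule sum.cong)
    fix E assume "E \<in> ?I"
    then have E: "E \<subseteq> ?V" by (auto simp: indep_def)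
    then have "card E \<le> card ?V" by (intro card_mono) auto
    \<comment> \<open>The split-off power cancels the denominator of
      \<open>(p / (1 - p)) ^ card E\<close>.\<close>
    then have "(1 - p) ^ card ?V = (1 - p) ^ (card ?V - card E) * (1 - p) ^ card E"
      by (simp add: power_add[symmetric])
    then show "pmf (erdos_renyi n p) E = (1 - p) ^ card ?V * (p / (1 - p)) ^ card E"
      using pmf_erdos_renyi[OF _ _ E, of p] p by (simp add: power_divide)
  qed simp
  finally show ?thesis by (simp add: ipoly_def sum_distrib_left)
qed

subsection \<open>The limit\<close>

lemma real_choose_two: "real (n choose 2) = real n * (real n - 1) / 2"
  by (induction n) (simp_all add: numeral_2_eq_2 field_simps)

lemma real_card_possible_edges: "real (card (possible_edges n)) = real n * (real n - 1) / 2"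
  by (simp add: possible_edges_eq_pairs card_pairs real_choose_two)

lemma card_possible_edges_le: "real (card (possible_edges n)) \<le> (real n)\<^sup>2"
  by (simp add: real_card_possible_edges power2_eq_square field_simps)

lemma empty_notin_triangle_edges: "{} \<notin> triangle_edges n"
  using card_triangle_edges by fastforce

text \<open>Every edge has ratio close to \<open>y / sqrt n\<close>, hence a term close to
  \<open>y / s = exp (- y\<^sup>2)\<close>, and there are about \<open>n\<^sup>2 / 2\<close>
  edges.\<close>

lemma mean_occ_prob_ratio_asymp:
  assumes y: "0 \<le> y" and s: "s = y * exp (y\<^sup>2)" "2 * s\<^sup>2 < 1"
  shows "(\<lambda>n. (\<Sum>v\<in>possible_edges n. occ_prob_ratio (possible_edges n) (triangle_edges n) (s / sqrt n) v)
           / (real n)\<^sup>2) \<longlonglongrightarrow> exp (- y\<^sup>2) / 2"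
proof -
  let ?V = possible_edges and ?T = triangle_edges
  let ?N = "\<lambda>n. real (card (?V n))"
  have N: "(\<lambda>n. ?N n / (real n)\<^sup>2) \<longlonglongrightarrow> 1 / 2"
    unfolding real_card_possible_edges by real_asymp
  show ?thesis
  proof (cases "y = 0")
    \<comment> \<open>Here the activity is 0 and every term is exactly 1; the other case divides by
      the activity.\<close>
    case True
    have "occ_prob_ratio (?V n) (?T n) 0 v = 1" for n v
    proof -
      have "{} \<notin> contr (?T n) v"
        using card_triangle_edges[of "{}" n] card_triangle_edges[of "{v}" n]
        by (auto simp: contr_def subset_singleton_iff)
      then show ?thesis by (simp add: occ_prob_ratio_def ipoly_0 empty_notin_triangle_edges)
    qed
    then show ?thesis using True N s by simp
  next
    case False
    with y have y: "0 < y" by simp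
    with s have s0: "0 < s" by simp
    define l where "l n = s / sqrt (real n)" for n
    define q where "q n v = occ_prob_ratio (?V n) (?T n) (l n) v" for n v
    have l0: "0 \<le> l n" for n using s0 by (simp add: l_def)
    have l_lim: "(\<lambda>n. l n * sqrt (real n)) \<longlonglongrightarrow> s"
      unfolding l_def by real_asymp
    have ys: "y = s * exp (- y\<^sup>2)" using s by (simp add: exp_minus)
    have "(\<lambda>n. (\<Sum>v\<in>?V n. q n v) / (real n)\<^sup>2 - ?N n / (real n)\<^sup>2 * (y / s)) \<longlonglongrightarrow> 0"
    proof (rule tendstoI)
      fix e :: real assume e: "0 < e"
      \<comment> \<open>Two errors of \<open>e * s / 4\<close>, one from the ratio and one from
        replacing \<open>r / (1 + r)\<close> by \<open>r\<close>, give \<open>e / 2\<close> per edge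
        after division by \<open>s\<close>.\<close>
      have "\<forall>\<^sub>F n in sequentially. \<forall>(A :: nat set set) C v. near_regular n 2 A C \<longrightarrow> v \<in> A \<longrightarrow>
          \<bar>occ_ratio A C (l n) v * sqrt (real n) - y\<bar> \<le> e * s / 4"
        by (rule occ_ratio_asymp[OF l0 l_lim s0]) (use s s0 y ys e in auto)
      moreover have "\<forall>\<^sub>F n in sequentially. l n < e / 4"
      proof (rule order_tendstoD)
        show "l \<longlonglongrightarrow> 0" unfolding l_def by real_asymp
      qed (use e in auto)
      ultimately show "\<forall>\<^sub>F n in sequentially.
          dist ((\<Sum>v\<in>?V n. q n v) / (real n)\<^sup>2 - ?N n / (real n)\<^sup>2 * (y / s)) 0 < e"
        using eventually_gt_at_top[of 0]
      proof eventually_elim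
        case (elim n)
        have q: "\<bar>q n v - y / s\<bar> \<le> e / 2" if v: "v \<in> ?V n" for v
        proof -
          define r where "r = occ_ratio (?V n) (?T n) (l n) v"
          have ln: "0 < l n" "l n * sqrt (real n) = s" using s0 elim by (auto simp: l_def)
          have r: "0 \<le> r" "r \<le> l n"
            unfolding r_def using near_regular_occ_ratio_le[OF near_regular_triangle_edges v l0] l0
            by (auto simp: occ_ratio_nonneg)
          have ry: "\<bar>r * sqrt (real n) - y\<bar> \<le> e * s / 4"
            using elim near_regular_triangle_edges[of n] v by (simp add: r_def)
          have "r * sqrt (real n) \<le> s" using mult_right_mono[OF r(2), of "sqrt (real n)"] ln by simp
          then have rs: "r * (r * sqrt (real n)) \<le> l n * s" using r s0 by (intro mult_mono) auto
          have "q n v = r / (1 + r) / l n"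
            unfolding q_def r_def
            by (rule occ_prob_ratio_eq) (use v ln empty_notin_triangle_edges in auto)
          also have "\<dots> = r * sqrt (real n) / (1 + r) / s" using elim by (simp add: l_def)
          finally have qr: "q n v - y / s = (r * sqrt (real n) / (1 + r) - y) / s"
            by (simp add: diff_divide_distrib)
          \<comment> \<open>The scaled difference between \<open>r\<close> and
            \<open>r / (1 + r)\<close>; it is at most \<open>l n * s\<close>, hence vanishes in the
            limit.\<close>
          define d where "d = r * (r * sqrt (real n)) / (1 + r)"
          have rd: "r * sqrt (real n) / (1 + r) = r * sqrt (real n) - d"
            using r by (simp add: d_def field_simps)
          have "d \<le> r * (r * sqrt (real n)) / 1"
            unfolding d_def using r by (intro divide_left_mono) auto
          moreover have "l n * s \<le> e / 4 * s" using elim s0 by (intro mult_right_mono) auto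
          moreover have "0 \<le> d" using r by (simp add: d_def)
          ultimately have "\<bar>r * sqrt (real n) - d - y\<bar> \<le> e * s / 2"
            using ry rs unfolding abs_le_iff by simp
          then have "\<bar>q n v - y / s\<bar> \<le> (e * s / 2) / s"
            unfolding qr rd abs_divide using s0 by (simp add: divide_le_eq)
          then show ?thesis using s0 by simp
        qed
        have "(\<Sum>v\<in>?V n. q n v) / (real n)\<^sup>2 - ?N n / (real n)\<^sup>2 * (y / s)
            = (\<Sum>v\<in>?V n. q n v - y / s) / (real n)\<^sup>2"
          by (simp add: sum_subtractf diff_divide_distrib)
        then have "\<bar>(\<Sum>v\<in>?V n. q n v) / (real n)\<^sup>2 - ?N n / (real n)\<^sup>2 * (y / s)\<bar>
            = \<bar>\<Sum>v\<in>?V n. q n v - y / s\<bar> / (real n)\<^sup>2"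
          by (simp only: abs_divide) simp
        also have "\<dots> \<le> ?N n * (e / 2) / (real n)\<^sup>2"
          by (intro divide_right_mono order_trans[OF sum_abs sum_bounded_above] q) auto
        also have "\<dots> \<le> e / 2"
          using mult_right_mono[OF card_possible_edges_le[of n], of "e / 2"] e elim
          by (simp add: divide_le_eq mult_ac)
        finally have "\<bar>(\<Sum>v\<in>?V n. q n v) / (real n)\<^sup>2 - ?N n / (real n)\<^sup>2 * (y / s)\<bar> \<le> e / 2" .
        then show ?case using e by (simp add: dist_real_def)
      qed
    qed
    from tendsto_add[OF this tendsto_mult_right[OF N, of "y / s"]]
    have "(\<lambda>n. (\<Sum>v\<in>?V n. q n v) / (real n)\<^sup>2) \<longlonglongrightarrow> 1 / 2 * (y / s)" by simp
    moreover have "y / s = exp (- y\<^sup>2)" using s y by (simp add: exp_minus field_simps)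
    ultimately show ?thesis by (simp add: q_def l_def)
  qed
qed

lemma sum_occ_prob_ratio_bounds:
  assumes "0 \<le> l"
  shows "0 \<le> (\<Sum>v\<in>possible_edges n. occ_prob_ratio (possible_edges n) (triangle_edges n) l v)"
    and "(\<Sum>v\<in>possible_edges n. occ_prob_ratio (possible_edges n) (triangle_edges n) l v)
      \<le> real (card (possible_edges n))"
proof -
  note b = occ_prob_ratio_bounds[OF finite_possible_edges empty_notin_triangle_edges assms]
  show "0 \<le> (\<Sum>v\<in>possible_edges n. occ_prob_ratio (possible_edges n) (triangle_edges n) l v)"
    by (intro sum_nonneg b)
  show "(\<Sum>v\<in>possible_edges n. occ_prob_ratio (possible_edges n) (triangle_edges n) l v)
      \<le> real (card (possible_edges n))"
    using sum_bounded_above[of "possible_edges n" _ "1 :: real"] b by simp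
qed

text \<open>The logarithm vanishes at activity 0, so it is the integral of its derivative along the
  path \<open>t n y\<close>. The bound of 1 on each \<open>occ_prob_ratio\<close> gives the
  domination needed to pass to the limit.\<close>

lemma ln_ipoly_asymp:
  assumes x: "0 \<le> x" "2 * (x * exp (x\<^sup>2))\<^sup>2 < 1"
  shows "(\<lambda>n. ln (ipoly (possible_edges n) (triangle_edges n) (x * exp (x\<^sup>2) / sqrt (real n)))
           / real n powr (3 / 2)) \<longlonglongrightarrow> x / 2 + x ^ 3 / 3"
proof -
  define F where "F n l = ln (ipoly (possible_edges n) (triangle_edges n) l)" for n and l :: real
  define S where "S n l = (\<Sum>v\<in>possible_edges n. occ_prob_ratio (possible_edges n) (triangle_edges n) l v)"
    for n and l :: real
  define t where "t n y = y * exp (y\<^sup>2) / sqrt (real n)" for n and y :: real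
  define f where "f n y = S n (t n y) * ((1 + 2 * y\<^sup>2) * exp (y\<^sup>2) / sqrt (real n)) / real n powr (3 / 2)"
    for n and y :: real
  have F: "(F n has_real_derivative S n l) (at l)" if "0 \<le> l" for n l
    unfolding F_def S_def
    by (rule has_real_derivative_ln_ipoly) (use that empty_notin_triangle_edges in auto)
  have t: "(t n has_real_derivative (1 + 2 * y\<^sup>2) * exp (y\<^sup>2) / sqrt (real n)) (at y)" for n y
    unfolding t_def
    by (intro DERIV_cdivide) (auto intro!: derivative_eq_intros simp: power2_eq_square algebra_simps)
  have t0: "0 \<le> t n y" if "0 \<le> y" for n y using that by (simp add: t_def)
  have int: "(f n has_integral F n (t n x) / real n powr (3 / 2)) {0..x}" for n
  proof -
    have "((\<lambda>y. F n (t n y) / real n powr (3 / 2)) has_real_derivative f n y) (at y)" if "0 \<le> y" for y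
      unfolding f_def by (intro DERIV_cdivide DERIV_chain2[OF F t] t0 that)
    then have "(f n has_integral F n (t n x) / real n powr (3 / 2) - F n (t n 0) / real n powr (3 / 2)) {0..x}"
      using x by (intro fundamental_theorem_of_calculus)
        (auto simp: has_real_derivative_iff_has_vector_derivative[symmetric] intro: has_field_derivative_at_within)
    moreover have "F n (t n 0) = 0"
      by (simp add: F_def t_def ipoly_0 empty_notin_triangle_edges)
    ultimately show ?thesis by simp
  qed
  \<comment> \<open>The factor \<open>1 / sqrt n\<close> of the path and the normalisation combine
    to \<open>1 / n\<^sup>2\<close>, the scale of the number of edges.\<close>
  have fn: "f n y = S n (t n y) / (real n)\<^sup>2 * ((1 + 2 * y\<^sup>2) * exp (y\<^sup>2))" for n y
  proof (cases "n = 0")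
    case False
    have "sqrt (real n) * real n powr (3 / 2) = real n powr (1 / 2 + 3 / 2)"
      by (simp only: powr_add powr_half_sqrt of_nat_0_le_iff)
    also have "\<dots> = (real n)\<^sup>2" using False by (simp add: powr_numeral)
    finally show ?thesis by (simp add: f_def mult_ac flip: divide_divide_eq_left')
  qed (simp add: f_def)
  have lim: "(\<lambda>n. integral {0..x} (f n)) \<longlonglongrightarrow> integral {0..x} (\<lambda>y. (1 + 2 * y\<^sup>2) / 2)"
  proof (rule dominated_convergence(2))
    show "f n integrable_on {0..x}" for n using int by blast
    show "(\<lambda>y. (1 + 2 * x\<^sup>2) * exp (x\<^sup>2)) integrable_on {0..x}" by (rule integrable_const_ivl)
  next
    fix n y assume "y \<in> {0..x}"
    then have y: "0 \<le> y" "y \<le> x" by auto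
    then have yx: "y\<^sup>2 \<le> x\<^sup>2" by (intro power_mono)
    have "S n (t n y) / (real n)\<^sup>2 \<le> 1"
      using order_trans[OF sum_occ_prob_ratio_bounds(2)[OF t0[OF y(1)], of n n] card_possible_edges_le[of n]]
      by (auto simp: S_def divide_le_eq_1)
    moreover have "0 \<le> S n (t n y)" using sum_occ_prob_ratio_bounds(1)[OF t0[OF y(1)]] by (simp add: S_def)
    moreover have "(1 + 2 * y\<^sup>2) * exp (y\<^sup>2) \<le> (1 + 2 * x\<^sup>2) * exp (x\<^sup>2)"
      using yx by (intro mult_mono) auto
    ultimately have "S n (t n y) / (real n)\<^sup>2 * ((1 + 2 * y\<^sup>2) * exp (y\<^sup>2)) \<le> 1 * ((1 + 2 * x\<^sup>2) * exp (x\<^sup>2))"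
      by - (rule mult_mono, simp_all)
    then show "norm (f n y) \<le> (1 + 2 * x\<^sup>2) * exp (x\<^sup>2)"
      using \<open>0 \<le> S n (t n y)\<close> by (simp add: fn)
  next
    fix y assume "y \<in> {0..x}"
    then have y: "0 \<le> y" "y \<le> x" by auto
    then have yx: "y\<^sup>2 \<le> x\<^sup>2" by (intro power_mono)
    \<comment> \<open>By monotonicity, the contraction condition at the end point \<open>x\<close>
      holds along the whole path.\<close>
    have "y * exp (y\<^sup>2) \<le> x * exp (x\<^sup>2)" using y yx by (intro mult_mono) auto
    then have "(y * exp (y\<^sup>2))\<^sup>2 \<le> (x * exp (x\<^sup>2))\<^sup>2" using y by (intro power_mono) auto
    then have "(\<lambda>n. S n (t n y) / (real n)\<^sup>2) \<longlonglongrightarrow> exp (- y\<^sup>2) / 2"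
      unfolding S_def t_def using x by (intro mean_occ_prob_ratio_asymp y refl) auto
    then have "(\<lambda>n. f n y) \<longlonglongrightarrow> exp (- y\<^sup>2) / 2 * ((1 + 2 * y\<^sup>2) * exp (y\<^sup>2))"
      unfolding fn by (rule tendsto_mult_right)
    also have "exp (- y\<^sup>2) / 2 * ((1 + 2 * y\<^sup>2) * exp (y\<^sup>2)) = (1 + 2 * y\<^sup>2) / 2"
      by (simp add: exp_minus field_simps)
    finally show "(\<lambda>n. f n y) \<longlonglongrightarrow> (1 + 2 * y\<^sup>2) / 2" .
  qed
  have "((\<lambda>y. (1 + 2 * y\<^sup>2) / 2) has_integral (x / 2 + x ^ 3 / 3 - (0 / 2 + 0 ^ 3 / 3))) {0..x}"
    using x by (intro fundamental_theorem_of_calculus)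
      (auto simp: has_real_derivative_iff_has_vector_derivative[symmetric] power2_eq_square field_simps
        intro!: derivative_eq_intros)
  from lim[unfolded integral_unique[OF int] integral_unique[OF this]] show ?thesis
    by (simp add: F_def t_def)
qed

text \<open>The derivative is a sum over the edges of terms between 0 and 1. This crude Lipschitz
  bound suffices to replace the activity \<open>p / (1 - p)\<close> by
  \<open>c / sqrt n\<close>.\<close>

lemma abs_ln_ipoly_diff_le:
  assumes "0 \<le> l" "0 \<le> l'"
  shows "\<bar>ln (ipoly (possible_edges n) (triangle_edges n) l) - ln (ipoly (possible_edges n) (triangle_edges n) l')\<bar>
    \<le> real (card (possible_edges n)) * \<bar>l - l'\<bar>"
  using assms
proof (induction l l' rule: linorder_wlog)
  case (le l l')
  define F where "F l = ln (ipoly (possible_edges n) (triangle_edges n) l)" for l :: real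
  define S where "S l = (\<Sum>v\<in>possible_edges n. occ_prob_ratio (possible_edges n) (triangle_edges n) l v)"
    for l :: real
  have "\<bar>F l - F l'\<bar> \<le> real (card (possible_edges n)) * \<bar>l - l'\<bar>"
  proof (cases "l = l'")
    case False
    with le have "l < l'" by simp
    moreover have "(F has_real_derivative S z) (at z)" if "l \<le> z" for z
      unfolding F_def S_def
      by (rule has_real_derivative_ln_ipoly) (use that le empty_notin_triangle_edges in auto)
    ultimately obtain z where z: "l < z" "F l' - F l = (l' - l) * S z"
      using MVT2[of l l' F S] by blast
    have "\<bar>S z\<bar> \<le> real (card (possible_edges n))"
      using sum_occ_prob_ratio_bounds[of z n] z le by (simp add: S_def)
    then have "\<bar>l' - l\<bar> * \<bar>S z\<bar> \<le> \<bar>l' - l\<bar> * real (card (possible_edges n))" by (intro mult_left_mono) auto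
    then show ?thesis using z by (simp add: abs_minus_commute[of l] abs_minus_commute[of "F l"] abs_mult mult_ac)
  qed simp
  then show ?case by (simp add: F_def)
next
  case (sym l l')
  then show ?case by (simp add: abs_minus_commute)
qed

theorem corollary1p2:
  fixes c :: real and p :: "nat \<Rightarrow> real"
  assumes "0 < c" and "c < exp (- 1 / 2)"
    and "\<And>n. 0 \<le> p n \<and> p n \<le> 1"
    and "p \<sim>[sequentially] (\<lambda>n. c * real n powr (- 1 / 2))"
  shows "(\<lambda>n. 1 / real n powr (3 / 2)
              * ln (measure_pmf.prob (erdos_renyi n (p n)) {E. num_triangles n E = 0}))
         \<longlonglongrightarrow> 1 / 2 * ((lambert_W (2 * c\<^sup>2) powr (3 / 2) + 3 * lambert_W (2 * c\<^sup>2) powr (1 / 2))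
                         / (3 * sqrt 2) - c)"
proof -
  let ?N = "\<lambda>n. real (card (possible_edges n))"
  define F where "F n l = ln (ipoly (possible_edges n) (triangle_edges n) l)" for n and l :: real
  \<comment> \<open>Chosen so that the Lambert equation for \<open>2 * c\<^sup>2\<close> becomes
    \<open>x * exp (x\<^sup>2) = c\<close>, which makes \<open>x\<close> the end point of the
    integration path.\<close>
  define x where "x = sqrt (lambert_W (2 * c\<^sup>2) / 2)"
  have W: "lambert_W (2 * c\<^sup>2) = 2 * x\<^sup>2" and x0: "0 \<le> x"
    using lambert_W_nonneg[of "2 * c\<^sup>2"] by (auto simp: x_def)
  have "(x * exp (x\<^sup>2))\<^sup>2 = x\<^sup>2 * exp (2 * x\<^sup>2)"
    by (simp add: power_mult_distrib exp_double)
  also have "\<dots> = c\<^sup>2" using lambert_W_mult_exp[of "2 * c\<^sup>2"] by (simp add: W)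
  finally have xc: "x * exp (x\<^sup>2) = c" using x0 assms(1) by (simp add: power2_eq_iff_nonneg)
  \<comment> \<open>The contraction condition at \<open>s = c\<close>: the square of
    \<open>c\<close> is below \<open>1 / exp 1\<close>, and \<open>exp 1\<close> is at least
    2.\<close>
  have c: "2 * c\<^sup>2 < 1"
  proof -
    have "c\<^sup>2 < (exp (- 1 / 2))\<^sup>2" using assms by (intro power_strict_mono) auto
    also have "\<dots> = exp (- 1)" by (simp add: power2_eq_square flip: exp_add)
    also have "\<dots> = 1 / exp (1 :: real)" by (simp add: exp_minus divide_inverse)
    also have "\<dots> \<le> 1 / 2" using exp_ge_add_one_self[of 1] by (intro divide_left_mono) auto
    finally show ?thesis by simp
  qed
  have "(\<lambda>n. p n * sqrt (real n)) \<sim>[sequentially] (\<lambda>n. c * real n powr (- 1 / 2) * sqrt (real n))"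
    by (intro asymp_equiv_intros assms)
  moreover have "(\<lambda>n. c * real n powr (- 1 / 2) * sqrt (real n)) \<longlonglongrightarrow> c" by real_asymp
  ultimately have pc: "(\<lambda>n. p n * sqrt (real n)) \<longlonglongrightarrow> c" by (simp add: tendsto_asymp_equiv_cong)
  have p0: "p \<longlonglongrightarrow> 0"
    using tendsto_asymp_equiv_cong[OF assms(4), of 0] by (simp) real_asymp
  have pos: "\<forall>\<^sub>F n in sequentially. 0 < p n"
    using order_tendstoD(1)[OF pc assms(1)] by eventually_elim (simp add: zero_less_mult_iff)
  have lt1: "\<forall>\<^sub>F n in sequentially. p n < 1" using order_tendstoD(2)[OF p0] by simp
  have p_right: "filterlim p (at_right 0) sequentially"
    using p0 pos by (auto simp: filterlim_at elim: eventually_mono)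
  have N: "(\<lambda>n. ?N n / (real n)\<^sup>2) \<longlonglongrightarrow> 1 / 2"
    unfolding real_card_possible_edges by real_asymp
  have n2: "real n powr (3 / 2) = (real n)\<^sup>2 / sqrt (real n)" if "0 < n" for n
  proof -
    have "real n powr (3 / 2) * sqrt (real n) = real n powr (3 / 2 + 1 / 2)"
      by (simp only: powr_add powr_half_sqrt of_nat_0_le_iff)
    also have "\<dots> = (real n)\<^sup>2" using that by (simp add: powr_numeral)
    finally show ?thesis using that by (simp add: eq_divide_eq)
  qed

  \<comment> \<open>The prefactor \<open>(1 - p) ^ N\<close> contributes \<open>- c / 2\<close>, as
    \<open>ln (1 - p)\<close> behaves like \<open>- p\<close> and \<open>N\<close> like
    \<open>n\<^sup>2 / 2\<close>.\<close>
  have "((\<lambda>q :: real. ln (1 - q) / q) \<longlongrightarrow> - 1) (at_right 0)" by real_asymp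
  from filterlim_compose[OF this p_right]
  have "(\<lambda>n. ?N n / (real n)\<^sup>2 * (p n * sqrt (real n)) * (ln (1 - p n) / p n)) \<longlonglongrightarrow> 1 / 2 * c * - 1"
    by (intro tendsto_mult N pc)
  moreover have "\<forall>\<^sub>F n in sequentially. ?N n / (real n)\<^sup>2 * (p n * sqrt (real n)) * (ln (1 - p n) / p n)
      = ?N n * ln (1 - p n) / real n powr (3 / 2)"
    using pos eventually_gt_at_top[of 0] by eventually_elim (simp add: n2)
  ultimately have lim1: "(\<lambda>n. ?N n * ln (1 - p n) / real n powr (3 / 2)) \<longlonglongrightarrow> 1 / 2 * c * - 1"
    by (rule Lim_transform_eventually)

  have "(\<lambda>n. p n * sqrt (real n) / (1 - p n) - c) \<longlonglongrightarrow> c / (1 - 0) - c"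
    by (intro tendsto_intros pc p0) auto
  then have s: "(\<lambda>n. \<bar>p n * sqrt (real n) / (1 - p n) - c\<bar>) \<longlonglongrightarrow> 0"
    by (intro tendsto_rabs_zero) simp
  \<comment> \<open>The Lipschitz constant is at most \<open>n\<^sup>2\<close>, and dividing it by
    \<open>n powr (3 / 2)\<close> leaves \<open>sqrt n\<close>, exactly the scaling under which the
    activities converge.\<close>
  have diff_lim: "(\<lambda>n. F n (p n / (1 - p n)) / real n powr (3 / 2) - F n (c / sqrt (real n)) / real n powr (3 / 2))
      \<longlonglongrightarrow> 0"
  proof (rule Lim_null_comparison[OF _ s])
    show "\<forall>\<^sub>F n in sequentially.
        norm (F n (p n / (1 - p n)) / real n powr (3 / 2) - F n (c / sqrt (real n)) / real n powr (3 / 2))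
        \<le> \<bar>p n * sqrt (real n) / (1 - p n) - c\<bar>"
      using lt1 eventually_gt_at_top[of 0]
    proof eventually_elim
      case (elim n)
      let ?d = "p n / (1 - p n) - c / sqrt (real n)"
      have "\<bar>F n (p n / (1 - p n)) - F n (c / sqrt (real n))\<bar> \<le> ?N n * \<bar>?d\<bar>"
        unfolding F_def by (rule abs_ln_ipoly_diff_le) (use assms elim in auto)
      also have "\<dots> \<le> (real n)\<^sup>2 * \<bar>?d\<bar>" by (intro mult_right_mono card_possible_edges_le) auto
      finally have "\<bar>F n (p n / (1 - p n)) - F n (c / sqrt (real n))\<bar> / real n powr (3 / 2)
          \<le> (real n)\<^sup>2 * \<bar>?d\<bar> / real n powr (3 / 2)" by (rule divide_right_mono) simp
      also have "\<dots> = \<bar>?d * sqrt (real n)\<bar>" using elim by (simp add: n2 abs_mult)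
      also have "?d * sqrt (real n) = p n * sqrt (real n) / (1 - p n) - c"
        using elim by (simp add: left_diff_distrib)
      finally show ?case by (simp flip: diff_divide_distrib)
    qed
  qed
  have "(\<lambda>n. F n (c / sqrt (real n)) / real n powr (3 / 2)) \<longlonglongrightarrow> x / 2 + x ^ 3 / 3"
    using ln_ipoly_asymp[OF x0] c unfolding xc F_def by simp
  from tendsto_add[OF diff_lim this]
  have lim2: "(\<lambda>n. F n (p n / (1 - p n)) / real n powr (3 / 2)) \<longlonglongrightarrow> 0 + (x / 2 + x ^ 3 / 3)"
    by simp
  have "(\<lambda>n. ?N n * ln (1 - p n) / real n powr (3 / 2) + F n (p n / (1 - p n)) / real n powr (3 / 2))
      \<longlonglongrightarrow> 1 / 2 * c * - 1 + (0 + (x / 2 + x ^ 3 / 3))"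
    by (rule tendsto_add[OF lim1 lim2])
  moreover have "\<forall>\<^sub>F n in sequentially.
      ?N n * ln (1 - p n) / real n powr (3 / 2) + F n (p n / (1 - p n)) / real n powr (3 / 2)
      = 1 / real n powr (3 / 2) * ln (measure_pmf.prob (erdos_renyi n (p n)) {E. num_triangles n E = 0})"
    using lt1
  proof eventually_elim
    case (elim n)
    have "0 \<le> p n" using assms by auto
    moreover have "1 \<le> ipoly (possible_edges n) (triangle_edges n) (p n / (1 - p n))"
      using elim \<open>0 \<le> p n\<close> by (intro ipoly_ge_1) (auto simp: empty_notin_triangle_edges)
    ultimately show ?case using elim
      by (simp add: prob_triangle_free ln_mult ln_realpow F_def add_divide_distrib)
  qed
  ultimately have "(\<lambda>n. 1 / real n powr (3 / 2)
      * ln (measure_pmf.prob (erdos_renyi n (p n)) {E. num_triangles n E = 0}))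
    \<longlonglongrightarrow> 1 / 2 * c * - 1 + (0 + (x / 2 + x ^ 3 / 3))"
    by (rule Lim_transform_eventually)
  \<comment> \<open>With \<open>W = 2 * x\<^sup>2\<close>, the powers of \<open>W\<close> are
    \<open>sqrt 2 * x\<close> and \<open>2 * sqrt 2 * x ^ 3\<close>, so the bracket equals
    \<open>x + 2 * x ^ 3 / 3 - c\<close>.\<close>
  moreover have "1 / 2 * c * - 1 + (0 + (x / 2 + x ^ 3 / 3))
      = 1 / 2 * ((lambert_W (2 * c\<^sup>2) powr (3 / 2) + 3 * lambert_W (2 * c\<^sup>2) powr (1 / 2)) / (3 * sqrt 2) - c)"
  proof -
    have half: "lambert_W (2 * c\<^sup>2) powr (1 / 2) = sqrt 2 * x"
      unfolding W using x0 by (simp add: powr_half_sqrt real_sqrt_mult)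
    have "lambert_W (2 * c\<^sup>2) powr (3 / 2) = lambert_W (2 * c\<^sup>2) powr (1 + 1 / 2)" by simp
    also have "\<dots> = 2 * x\<^sup>2 * (sqrt 2 * x)"
      unfolding powr_add half by (simp add: W)
    finally have "lambert_W (2 * c\<^sup>2) powr (3 / 2) = sqrt 2 * (2 * x ^ 3)"
      by (simp add: power2_eq_square power3_eq_cube)
    then show ?thesis unfolding half by (simp add: field_simps)
  qed
  ultimately show ?thesis by (rule tendsto_eq_rhs)
qed

end
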